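(* Let $(\mathbb{R}^n,g)$ be a pseudo-Euclidean space, $n\ge 3$, with coordinates $x=(x_1,\dots,x_n)$ and $g_{ij}=\delta_{ij}\varepsilon_i$, $\varepsilon_i\in\{-1,1\}$. Let $M=(\mathbb{R}^n,\bar g)\times_f F^m$ be a warped product, where $\bar g=\frac{1}{\varphi^2}g$, $F$ is a scalar-flat semi-Riemannian manifold of dimension $m\ge 1$, and $f,\varphi,h:\mathbb{R}^n\to\mathbb{R}$ are smooth functions with $f>0$ which are functions $f(\xi),\varphi(\xi),h(\xi)$ of $\xi=\sum_{k=1}^n\alpha_kx_k$, where $\alpha_k\in\mathbb{R}$ and $\sum_{k=1}^n\varepsilon_k\alpha_k^2=\varepsilon_{k_0}\in\{-1,1\}$. Then the warped product metric $\tilde g=\bar g\oplus f^2g_F$ is a steady gradient Yamabe soliton with potential function $h$ and $h'\ne 0$ if and only if $f,h,\varphi$ satisfy $$f(\xi)=\frac{e^{c}}{\varphi(\xi)},$$ $$h(\xi)=\alpha\int\frac{1}{\varphi^2(\xi)}\,d\xi,$$ $$(n+m-1)(n+m+2)\int\frac{\varphi\,d\varphi}{\alpha-\frac{2\beta(n+m-1)(n+m+2)}{n+m-2}\varphi^{\frac{n+m}{2}+1}}=\xi+\nu,$$ for some constants $c,\nu,\alpha,\beta\in\mathbb{R}$ with $\alpha\ne 0$.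
   Context: A pseudo-Riemannian manifold $(M,g)$ is a gradient Yamabe soliton with potential function $h$ if there is a real constant $\rho$ with $(S_g-\rho)g=\mathrm{Hess}_g(h)$, where $S_g$ is the scalar curvature; it is steady if $\rho=0$, i.e. $S_g\,g=\mathrm{Hess}_g(h)$. The warped product $B\times_f F$ is $B\times F$ with metric $\tilde g=g_B\oplus f^2g_F$. Scalar-flat means scalar curvature identically zero. The function $h$ on $\mathbb{R}^n$ is regarded as a function on $M=\mathbb{R}^n\times F$ by composing with the projection to $\mathbb{R}^n$. Since $\bar g=\frac1{\varphi^2}g$ must be a metric, $\varphi$ is nowhere zero. Primes denote derivatives with respect to $\xi$. Integrals are indefinite integrals (antiderivatives, determined up to an additive constant); the third equation is an implicit equation for $\varphi(\xi)$: an antiderivative of the integrand, viewed as a function of the real variable $\varphi$, evaluated at $\varphi=\varphi(\xi)$ and multiplied by the prefactor, equals $\xi+\nu$.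
   Formalization: φ is assumed nonconstant: for φ=f=1, h=ξ, F flat, the metric is a steady soliton with h'≠0 but the third equation fails. Also, ξ may range over any open interval instead of all of ℝ (with φ>0 if it is proper). *)

theory Defs
  imports "HOL-Analysis.Analysis"
begin

text \<open>Both predicates are meant for open sets \<open>S\<close> of a finite-dimensional space; there
  \<open>ck_on k f S\<close> says that \<open>f\<close> is of class $C^k$ on \<open>S\<close>.\<close>

primrec ck_on ::
  "nat \<Rightarrow> ('a::real_normed_vector \<Rightarrow> 'b::real_normed_vector) \<Rightarrow> 'a set \<Rightarrow> bool" where
  "ck_on 0 f S \<longleftrightarrow> continuous_on S f"
| "ck_on (Suc k) f S \<longleftrightarrow>
     (\<forall>x\<in>S. f differentiable (at x)) \<and>
     (\<forall>v. ck_on k (\<lambda>x. frechet_derivative f (at x) v) S)"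

definition smooth_on ::
  "'a set \<Rightarrow> ('a::real_normed_vector \<Rightarrow> 'b::real_normed_vector) \<Rightarrow> bool" where
  "smooth_on S f \<longleftrightarrow> (\<forall>k. ck_on k f S)"

text \<open>\<open>G x\<close> is the Gram matrix $(g_{ij}(x))$ of a metric in local coordinates.\<close>

definition pd :: "'k::finite \<Rightarrow> (real^'k \<Rightarrow> real) \<Rightarrow> real^'k \<Rightarrow> real" where
  "pd i u x = frechet_derivative u (at x) (axis i 1)"

text \<open>\<open>christoffel G l i j\<close> is $\Gamma^l_{ij}$.\<close>

definition christoffel ::
  "(real^'k \<Rightarrow> real^'k^'k) \<Rightarrow> 'k \<Rightarrow> 'k \<Rightarrow> 'k \<Rightarrow> real^'k \<Rightarrow> real" where
  "christoffel G l i j x =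
     (\<Sum>s\<in>UNIV. matrix_inv (G x) $ l $ s *
        (pd i (\<lambda>y. G y $ j $ s) x + pd j (\<lambda>y. G y $ i $ s) x - pd s (\<lambda>y. G y $ i $ j) x)) / 2"

text \<open>\<open>riemann G l i j k\<close> is the coefficient of $\partial_l$ in
  $R(\partial_i,\partial_j)\partial_k
    = \nabla_i\nabla_j\partial_k - \nabla_j\nabla_i\partial_k$.
  With this sign the round sphere has positive scalar curvature.\<close>

definition riemann ::
  "(real^'k \<Rightarrow> real^'k^'k) \<Rightarrow> 'k \<Rightarrow> 'k \<Rightarrow> 'k \<Rightarrow> 'k \<Rightarrow> real^'k \<Rightarrow> real" where
  "riemann G l i j k x =
     pd i (christoffel G l j k) x - pd j (christoffel G l i k) x
     + (\<Sum>s\<in>UNIV. christoffel G l i s x * christoffel G s j k x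
                - christoffel G l j s x * christoffel G s i k x)"

definition ricci :: "(real^'k \<Rightarrow> real^'k^'k) \<Rightarrow> 'k \<Rightarrow> 'k \<Rightarrow> real^'k \<Rightarrow> real" where
  "ricci G j k x = (\<Sum>i\<in>UNIV. riemann G i i j k x)"

definition scalar_curvature :: "(real^'k \<Rightarrow> real^'k^'k) \<Rightarrow> real^'k \<Rightarrow> real" where
  "scalar_curvature G x = (\<Sum>j\<in>UNIV. \<Sum>k\<in>UNIV. matrix_inv (G x) $ j $ k * ricci G j k x)"

definition hessian ::
  "(real^'k \<Rightarrow> real^'k^'k) \<Rightarrow> (real^'k \<Rightarrow> real) \<Rightarrow> real^'k \<Rightarrow> real^'k^'k" where
  "hessian G u x = (\<chi> i j. pd i (pd j u) x - (\<Sum>l\<in>UNIV. christoffel G l i j x * pd l u x))"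

text \<open>A manifold with metric is presented by its topology and an atlas (not necessarily maximal),
  each chart carrying the Gram matrix of the metric as a function on the coordinate domain.\<close>

record ('q, 'k) mchart =
  cdom :: "'q set"
  coord :: "'q \<Rightarrow> real^'k"
  gram :: "real^'k \<Rightarrow> real^'k^'k"

record ('q, 'k) mmanifold =
  mtop :: "'q topology"
  charts :: "('q, 'k) mchart set"

definition crange :: "('q, 'k::finite) mchart \<Rightarrow> (real^'k) set" where
  "crange c = coord c ` cdom c"

definition cinv :: "('q, 'k::finite) mchart \<Rightarrow> real^'k \<Rightarrow> 'q" where
  "cinv c = inv_into (cdom c) (coord c)"

definition transition ::
  "('q, 'k::finite) mchart \<Rightarrow> ('q, 'k) mchart \<Rightarrow> real^'k \<Rightarrow> real^'k" where
  "transition c d = coord d \<circ> cinv c"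

definition smooth_manifold :: "('q, 'k::finite) mmanifold \<Rightarrow> bool" where
  "smooth_manifold M \<longleftrightarrow>
     Hausdorff_space (mtop M) \<and> second_countable (mtop M) \<and> topspace (mtop M) \<noteq> {} \<and>
     (\<Union>c\<in>charts M. cdom c) = topspace (mtop M) \<and>
     (\<forall>c\<in>charts M. openin (mtop M) (cdom c) \<and> open (crange c) \<and>
        homeomorphic_map (subtopology (mtop M) (cdom c)) (top_of_set (crange c)) (coord c)) \<and>
     (\<forall>c\<in>charts M. \<forall>d\<in>charts M. smooth_on (coord c ` (cdom c \<inter> cdom d)) (transition c d))"

text \<open>The last clause is the transformation law of a covariant 2-tensor.  For two charts with the
  same domain and coordinates it forces the two Gram matrices to agree.\<close>

definition semi_riemannian_manifold :: "('q, 'k::finite) mmanifold \<Rightarrow> bool" where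
  "semi_riemannian_manifold M \<longleftrightarrow>
     smooth_manifold M \<and>
     (\<forall>c\<in>charts M. smooth_on (crange c) (gram c) \<and>
        (\<forall>x\<in>crange c. transpose (gram c x) = gram c x \<and> invertible (gram c x))) \<and>
     (\<forall>c\<in>charts M. \<forall>d\<in>charts M. \<forall>x\<in>coord c ` (cdom c \<inter> cdom d).
        let J = matrix (frechet_derivative (transition c d) (at x))
        in gram c x = transpose J ** gram d (transition c d x) ** J)"

definition scalar_flat :: "('q, 'k::finite) mmanifold \<Rightarrow> bool" where
  "scalar_flat M \<longleftrightarrow> (\<forall>c\<in>charts M. \<forall>x\<in>crange c. scalar_curvature (gram c) x = 0)"

text \<open>The tensor equation $(S_g-\rho)g = \mathrm{Hess}_g(h)$, written out in every chart.\<close>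

definition gradient_yamabe_soliton ::
  "('q, 'k::finite) mmanifold \<Rightarrow> ('q \<Rightarrow> real) \<Rightarrow> real \<Rightarrow> bool" where
  "gradient_yamabe_soliton M h \<rho> \<longleftrightarrow>
     (\<forall>c\<in>charts M. \<forall>x\<in>crange c.
        (scalar_curvature (gram c) x - \<rho>) *\<^sub>R gram c x = hessian (gram c) (h \<circ> cinv c) x)"

definition steady_gradient_yamabe_soliton ::
  "('q, 'k::finite) mmanifold \<Rightarrow> ('q \<Rightarrow> real) \<Rightarrow> bool" where
  "steady_gradient_yamabe_soliton M h \<longleftrightarrow> gradient_yamabe_soliton M h 0"

text \<open>The coordinate space of a product is indexed by the sum of the two index types.\<close>

definition vec_join :: "real^'n \<Rightarrow> real^'m \<Rightarrow> real^('n::finite + 'm::finite)" where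
  "vec_join x y = (\<chi> k. case k of Inl i \<Rightarrow> x $ i | Inr j \<Rightarrow> y $ j)"

definition vec_fst :: "real^('n::finite + 'm::finite) \<Rightarrow> real^'n" where
  "vec_fst z = (\<chi> i. z $ Inl i)"

definition vec_snd :: "real^('n::finite + 'm::finite) \<Rightarrow> real^'m" where
  "vec_snd z = (\<chi> j. z $ Inr j)"

definition block_diag ::
  "real^'n^'n \<Rightarrow> real^'m^'m \<Rightarrow> real^('n::finite + 'm::finite)^('n + 'm)" where
  "block_diag P Q = (\<chi> k l. case k of
       Inl i \<Rightarrow> (case l of Inl i' \<Rightarrow> P $ i $ i' | Inr _ \<Rightarrow> 0)
     | Inr j \<Rightarrow> (case l of Inl _ \<Rightarrow> 0 | Inr j' \<Rightarrow> Q $ j $ j'))"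

definition warped_chart ::
  "('p \<Rightarrow> real) \<Rightarrow> ('p, 'n::finite) mchart \<Rightarrow> ('q, 'm::finite) mchart \<Rightarrow> ('p \<times> 'q, 'n + 'm) mchart"
where
  "warped_chart f c d =
     \<lparr> cdom = cdom c \<times> cdom d,
       coord = (\<lambda>(p, q). vec_join (coord c p) (coord d q)),
       gram = (\<lambda>z. block_diag (gram c (vec_fst z))
                       ((f (cinv c (vec_fst z)))\<^sup>2 *\<^sub>R gram d (vec_snd z))) \<rparr>"

definition warped_product ::
  "('p, 'n::finite) mmanifold \<Rightarrow> ('p \<Rightarrow> real) \<Rightarrow> ('q, 'm::finite) mmanifold
     \<Rightarrow> ('p \<times> 'q, 'n + 'm) mmanifold" where
  "warped_product B f F =
     \<lparr> mtop = prod_topology (mtop B) (mtop F),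
       charts = (\<lambda>(c, d). warped_chart f c d) ` (charts B \<times> charts F) \<rparr>"

text \<open>The open set \<open>U\<close> of $\mathbb{R}^n$ with the metric
  $\varphi^{-2}\sum_i \varepsilon_i\,dx_i^2$ and the identity as its only chart.\<close>

definition conformal_pseudo_euclidean ::
  "(real^'n) set \<Rightarrow> ('n \<Rightarrow> real) \<Rightarrow> (real^'n \<Rightarrow> real) \<Rightarrow> (real^'n, 'n::finite) mmanifold" where
  "conformal_pseudo_euclidean U \<epsilon> \<phi> =
     \<lparr> mtop = top_of_set U,
       charts = {\<lparr> cdom = U, coord = (\<lambda>x. x),
                   gram = (\<lambda>x. \<chi> i j. if i = j then \<epsilon> i / (\<phi> x)\<^sup>2 else 0) \<rparr>} \<rparr>"

definition lin_form :: "real^'n \<Rightarrow> real^'n::finite \<Rightarrow> real" where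
  "lin_form a x = (\<Sum>k\<in>UNIV. a $ k * x $ k)"

text \<open>The open set \<open>{x. \<xi> x \<in> J}\<close> on which functions of \<open>\<xi> = lin_form a\<close> with profile defined
  on \<open>J\<close> live; it is the whole of $\mathbb{R}^n$ for \<open>J = UNIV\<close>.\<close>

definition strip :: "real^'n \<Rightarrow> real set \<Rightarrow> (real^'n::finite) set" where
  "strip a J = {x. lin_form a x \<in> J}"

end

theory Submission
  imports Defs
begin

text \<open>Write \<open>N = n + m\<close>, \<open>q = \<Sum>\<^sub>k \<epsilon>\<^sub>k a\<^sub>k\<^sup>2 = \<plusminus>1\<close> and let primes denote derivatives in \<open>\<xi>\<close>.

  The soliton equation is \<open>S \<cdot> metric = Hess h\<close>, and its right-hand side needs only Christoffel symbols.
  Comparing the blocks of the warped product splits it into three scalar equations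
  (\<open>soliton_at_point\<close>): \<open>h''\<phi> + 2\<phi>'h' = 0\<close> from the base,
  because \<open>n \<ge> 2\<close> forces the part proportional to \<open>a\<^sub>i a\<^sub>j\<close> to vanish;
  \<open>S = -q\<phi>\<phi>'h'\<close> from the rest of the base block; and \<open>S f = q\<phi>\<^sup>2f'h'\<close> from the fibre.
  The first says that \<open>\<phi>\<^sup>2h' = \<alpha>\<close> is constant.  The other two give \<open>(f\<phi>)' = 0\<close>
  without any knowledge of \<open>S\<close>.

  Only now is the scalar curvature needed, and with \<open>f = C/\<phi>\<close> the metric is
  \<open>\<phi>\<^sup>-\<^sup>2\<close> times the product of a constant metric with \<open>C\<^sup>2g\<^sub>F\<close>.  That product is scalar-flat, and \<open>\<xi>\<close> has
  a parallel gradient with respect to it, so the conformal transformation law takes the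
  short form \<open>S = (N-1)(2\<phi>\<phi>'' - N\<phi>'\<^sup>2) q\<close> (\<open>scalar_curvature_conformal\<close>).

  There remains \<open>(N-1)(2\<phi>\<phi>'' - N\<phi>'\<^sup>2) = -\<alpha>\<phi>'/\<phi>\<close>.  For \<open>\<phi> > 0\<close> it has the first integral
  \<open>\<phi>\<phi>' = \<alpha>/((N-1)(N+2)) + K\<phi>\<^bsup>N/2+1\<^esup>\<close>, in which the variables separate; this is the
  implicit formula for \<open>\<phi>\<close>, with \<open>K = -2\<beta>/(N-2)\<close>.  A nonconstant \<open>\<phi>\<close> has no critical point, since
  the equation is linear homogeneous in \<open>\<phi>'\<close>; hence \<open>\<phi>\<close> can be inverted.

  The formula \<open>f = e\<^sup>c/\<phi>\<close> demands \<open>\<phi> > 0\<close>.  A negative \<open>\<phi>\<close> is admitted only when it is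
  defined on the whole line, and there \<open>-\<phi>\<close> would be a nonconstant positive global solution of the same
  equation.  There is none: in one direction such a solution reaches \<open>0\<close> or blows up in
  finite time (\<open>yamabe_ode_no_global_solution\<close>).\<close>

section \<open>Partial derivatives and differentiability classes\<close>

lemma pd_eqI: "(u has_derivative u') (at x) \<Longrightarrow> pd i u x = u' (axis i 1)"
  unfolding pd_def by (simp add: frechet_derivative_at[symmetric])

lemma has_derivative_cong_open:
  assumes "open W" "x \<in> W" "\<And>y. y \<in> W \<Longrightarrow> u y = v y"
  shows "(u has_derivative D) (at x) \<longleftrightarrow> (v has_derivative D) (at x)"
  using assms by (metis has_derivative_transform_within_open)

lemma frechet_derivative_cong_open:
  assumes "open W" "x \<in> W" "\<And>y. y \<in> W \<Longrightarrow> u y = v y"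
  shows "frechet_derivative u (at x) = frechet_derivative v (at x)"
  unfolding frechet_derivative_def by (simp add: has_derivative_cong_open[OF assms])

lemma differentiable_cong_open:
  assumes "open W" "x \<in> W" "\<And>y. y \<in> W \<Longrightarrow> u y = v y"
  shows "u differentiable at x \<longleftrightarrow> v differentiable at x"
  unfolding differentiable_def by (simp add: has_derivative_cong_open[OF assms])

lemma pd_cong_open:
  assumes "open W" "x \<in> W" "\<And>y. y \<in> W \<Longrightarrow> u y = v y"
  shows "pd i u x = pd i v x"
  unfolding pd_def by (simp add: frechet_derivative_cong_open[OF assms])

lemma pd_const [simp]: "pd i (\<lambda>z. c) x = 0"
  by (simp add: pd_def)

lemma pd_diff:
  assumes "u differentiable at x" "v differentiable at x"
  shows "pd i (\<lambda>z. u z - v z) x = pd i u x - pd i v x"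
proof -
  have "((\<lambda>z. u z - v z) has_derivative
      (\<lambda>w. frechet_derivative u (at x) w - frechet_derivative v (at x) w)) (at x)"
    using assms by (intro has_derivative_diff) (simp_all flip: frechet_derivative_works)
  from pd_eqI[OF this] show ?thesis by (simp add: pd_def)
qed

lemma pd_mult:
  assumes "u differentiable at x" "v differentiable at x"
  shows "pd i (\<lambda>z. u z * v z) x = pd i u x * v x + u x * pd i v x"
proof -
  have "((\<lambda>z. u z * v z) has_derivative
      (\<lambda>w. u x * frechet_derivative v (at x) w + frechet_derivative u (at x) w * v x)) (at x)"
    using assms by (intro has_derivative_mult) (simp_all flip: frechet_derivative_works)
  from pd_eqI[OF this] show ?thesis by (simp add: pd_def)
qed

lemma pd_sum:
  assumes "\<And>s. s \<in> A \<Longrightarrow> (u s) differentiable at x"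
  shows "pd i (\<lambda>z. \<Sum>s\<in>A. u s z) x = (\<Sum>s\<in>A. pd i (u s) x)"
proof -
  have "((\<lambda>z. \<Sum>s\<in>A. u s z) has_derivative
      (\<lambda>w. \<Sum>s\<in>A. frechet_derivative (u s) (at x) w)) (at x)"
    using assms by (intro has_derivative_sum) (simp flip: frechet_derivative_works)
  from pd_eqI[OF this] show ?thesis by (simp add: pd_def)
qed

lemma lin_form_bounded_linear: "bounded_linear (lin_form a)"
  unfolding lin_form_def
  by (intro bounded_linear_sum bounded_linear_mult_right
        bounded_linear_compose[OF bounded_linear_mult_right bounded_linear_vec_nth])

lemma lin_form_axis [simp]: "lin_form a (axis i 1) = a $ i"
  by (simp add: lin_form_def axis_def if_distrib cong: if_cong)

lemma lin_form_scale: "lin_form a (c *\<^sub>R x) = c * lin_form a x"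
  by (simp add: lin_form_def sum_distrib_left mult.left_commute)

lemma has_derivative_lin_form:
  assumes "(g has_real_derivative g') (at (lin_form a x))"
  shows "((\<lambda>z. g (lin_form a z)) has_derivative (\<lambda>v. g' * lin_form a v)) (at x)"
  using has_derivative_compose[OF bounded_linear_imp_has_derivative[OF lin_form_bounded_linear]
      assms[unfolded has_field_derivative_def]] by simp

lemma pd_lin_form:
  assumes "(g has_real_derivative g') (at (lin_form a x))"
  shows "pd i (\<lambda>z. g (lin_form a z)) x = g' * a $ i"
  using pd_eqI[OF has_derivative_lin_form[OF assms]] by simp

lemma differentiable_lin_form:
  assumes "(g has_real_derivative g') (at (lin_form a x))"
  shows "(\<lambda>z. g (lin_form a z)) differentiable at x"
  using has_derivative_lin_form[OF assms] differentiableI by blast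

lemma open_strip: "open J \<Longrightarrow> open (strip a J)"
  unfolding strip_def
  using open_vimage[of J "lin_form a"] linear_continuous_on[OF lin_form_bounded_linear, of UNIV a]
  by (simp add: vimage_def)

lemma ck_on_cong_open:
  assumes "open S" "\<And>x. x \<in> S \<Longrightarrow> u x = v x"
  shows "ck_on k u S \<longleftrightarrow> ck_on k v S"
  using assms(2)
proof (induction k arbitrary: u v)
  case 0
  then show ?case by (simp cong: continuous_on_cong)
next
  case (Suc k)
  have "ck_on k (\<lambda>x. frechet_derivative u (at x) w) S
      \<longleftrightarrow> ck_on k (\<lambda>x. frechet_derivative v (at x) w) S" for w
    by (rule Suc.IH) (simp add: frechet_derivative_cong_open[OF assms(1) _ Suc.prems])
  then show ?case
    using differentiable_cong_open[OF assms(1) _ Suc.prems] by auto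
qed

lemma ck_on_bounded_linear:
  assumes L: "bounded_linear L" and "open S" "ck_on k u S"
  shows "ck_on k (\<lambda>x. L (u x)) S"
  using assms(3)
proof (induction k arbitrary: u)
  case 0
  then show ?case using L by (simp add: bounded_linear.continuous_on)
next
  case (Suc k)
  have D: "((\<lambda>x. L (u x)) has_derivative (\<lambda>v. L (frechet_derivative u (at x) v))) (at x)"
    if "x \<in> S" for x
    using that Suc.prems by (intro bounded_linear.has_derivative[OF L] iffD1[OF frechet_derivative_works]) auto
  have "ck_on k (\<lambda>x. frechet_derivative (\<lambda>x. L (u x)) (at x) v) S" for v
    using Suc.IH[of "\<lambda>x. frechet_derivative u (at x) v"] Suc.prems
      ck_on_cong_open[OF \<open>open S\<close>, of "\<lambda>x. frechet_derivative (\<lambda>x. L (u x)) (at x) v"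
         "\<lambda>x. L (frechet_derivative u (at x) v)" k]
    by (simp add: frechet_derivative_at[OF D, symmetric])
  then show ?case using D differentiableI by fastforce
qed

text \<open>A function of \<open>lin_form a\<close> inherits its one-variable derivatives from its restriction to a
  line in a direction \<open>v\<close> with \<open>lin_form a v = 1\<close>.\<close>

lemma ck_on_profile:
  assumes v: "lin_form a v = 1" and J: "open J"
    and ck: "ck_on (Suc k) (\<lambda>x. g (lin_form a x)) (strip a J)"
  shows "\<forall>t\<in>J. (g has_real_derivative deriv g t) (at t)"
    and "ck_on k (\<lambda>x. deriv g (lin_form a x)) (strip a J)"
proof -
  have *: "(g has_real_derivative deriv g t) (at t)" if "t \<in> J" for t
  proof -
    have t: "lin_form a (t *\<^sub>R v) = t" for t by (simp add: lin_form_scale v)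
    have "t *\<^sub>R v \<in> strip a J" using that by (simp add: strip_def t)
    then obtain D where "((\<lambda>x. g (lin_form a x)) has_derivative D) (at (t *\<^sub>R v))"
      using ck unfolding ck_on.simps differentiable_def by blast
    moreover have "((\<lambda>t. t *\<^sub>R v) has_derivative (\<lambda>s. s *\<^sub>R v)) (at t)"
      by (intro has_derivative_scaleR_left has_derivative_ident)
    ultimately have "((\<lambda>s. g (lin_form a (s *\<^sub>R v))) has_derivative (\<lambda>s. D (s *\<^sub>R v))) (at t)"
      using has_derivative_compose[of "\<lambda>t. t *\<^sub>R v" "\<lambda>s. s *\<^sub>R v" t UNIV
         "\<lambda>x. g (lin_form a x)" D] by simp
    then have "g differentiable at t" unfolding t by (rule differentiableI)
    then show ?thesis
      by (simp add: DERIV_deriv_iff_real_differentiable)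
  qed
  then show "\<forall>t\<in>J. (g has_real_derivative deriv g t) (at t)" by blast
  have "frechet_derivative (\<lambda>x. g (lin_form a x)) (at x) v = deriv g (lin_form a x)"
    if "x \<in> strip a J" for x
    using that frechet_derivative_at[OF has_derivative_lin_form[OF *, of a x], symmetric]
    by (simp add: strip_def v fun_eq_iff)
  moreover have "ck_on k (\<lambda>x. frechet_derivative (\<lambda>x. g (lin_form a x)) (at x) v) (strip a J)"
    using ck by simp
  ultimately show "ck_on k (\<lambda>x. deriv g (lin_form a x)) (strip a J)"
    by (subst (asm) ck_on_cong_open[OF open_strip[OF J, of a]])
qed

lemma smooth_profile:
  assumes v: "lin_form a v = 1" and J: "open J"
    and "smooth_on (strip a J) (\<lambda>x. g (lin_form a x))"
  shows "\<forall>t\<in>J. (g has_real_derivative deriv g t) (at t)"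
    and "\<forall>t\<in>J. (deriv g has_real_derivative deriv (deriv g) t) (at t)"
proof -
  have ck: "ck_on (Suc (Suc 0)) (\<lambda>x. g (lin_form a x)) (strip a J)"
    using assms(3) unfolding smooth_on_def by blast
  show "\<forall>t\<in>J. (g has_real_derivative deriv g t) (at t)" by (rule ck_on_profile[OF v J ck])
  show "\<forall>t\<in>J. (deriv g has_real_derivative deriv (deriv g) t) (at t)"
    by (rule ck_on_profile(1)[OF v J ck_on_profile(2)[OF v J ck]])
qed

text \<open>The exact regularity that the coefficients of a metric need for its curvature to be
  computed by the product and quotient rules.\<close>

definition twice_differentiable :: "(real^'k::finite) set \<Rightarrow> (real^'k \<Rightarrow> real) \<Rightarrow> bool" where
  "twice_differentiable W u \<longleftrightarrow>
     (\<forall>z\<in>W. u differentiable at z \<and> (\<forall>i. pd i u differentiable at z))"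

lemma smooth_matrix_entry:
  fixes G :: "real^'k::finite \<Rightarrow> real^'k^'k"
  assumes "open W" "smooth_on W G"
  shows "twice_differentiable W (\<lambda>z. G z $ i $ j)"
proof -
  have "ck_on (Suc (Suc 0)) (\<lambda>z. G z $ i $ j) W"
    using assms unfolding smooth_on_def
    by (intro ck_on_bounded_linear[of "\<lambda>A. A $ i $ j"] bounded_linear_compose[OF bounded_linear_vec_nth bounded_linear_vec_nth]) auto
  then show ?thesis unfolding twice_differentiable_def pd_def ck_on.simps by blast
qed

section \<open>Inverse Gram matrices and Christoffel symbols\<close>

lemma det_differentiable:
  fixes G :: "'a::real_normed_vector \<Rightarrow> real^'k::finite^'k"
  assumes "\<And>i j. (\<lambda>z. G z $ i $ j) differentiable at z"
  shows "(\<lambda>z. det (G z)) differentiable at z"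
proof -
  have "(\<lambda>z. \<Prod>i\<in>A. G z $ i $ p i) differentiable at z" if "finite A" for p A
    using that by induction (auto intro!: differentiable_mult assms)
  then show ?thesis
    unfolding det_def by (intro differentiable_sum differentiable_mult) auto
qed

lemma matrix_inv_unique:
  fixes A B :: "real^'k::finite^'k"
  assumes "A ** B = mat 1"
  shows "matrix_inv A = B"
proof -
  have "B ** A = mat 1" using assms matrix_left_right_inverse by blast
  then have "A ** matrix_inv A = mat 1"
    unfolding matrix_inv_def using assms
    by (intro conjunct1[OF someI[of "\<lambda>C. A ** C = mat 1 \<and> C ** A = mat 1" B]]) simp
  then have "B ** (A ** matrix_inv A) = B" by simp
  then show ?thesis
    by (simp add: matrix_mul_assoc \<open>B ** A = mat 1\<close>)
qed

lemma matrix_inv_right_left: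
  fixes A :: "real^'k::finite^'k"
  assumes "invertible A"
  shows "A ** matrix_inv A = mat 1" "matrix_inv A ** A = mat 1"
proof -
  obtain B where "A ** B = mat 1" "B ** A = mat 1" using assms unfolding invertible_def by blast
  then show "A ** matrix_inv A = mat 1" "matrix_inv A ** A = mat 1"
    using matrix_inv_unique[of A B] by simp_all
qed

text \<open>Cramer's rule shows how the inverse depends on the matrix: its entries are quotients of
  polynomials, hence as differentiable as the entries of the matrix.\<close>

lemma matrix_inv_entry:
  fixes A :: "real^'k::finite^'k"
  assumes "invertible A"
  shows "matrix_inv A $ l $ s =
     det (\<chi> i j. if j = l then axis s 1 $ i else A $ i $ j) / det A"
proof -
  have "A *v (matrix_inv A *v axis s 1) = axis s 1"
    using assms by (simp add: matrix_vector_mul_assoc matrix_inv_right_left)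
  then have "matrix_inv A *v axis s 1 =
      (\<chi> k. det (\<chi> i j. if j = k then axis s 1 $ i else A $ i $ j) / det A)"
    using cramer assms invertible_det_nz by blast
  then show ?thesis
    by (simp add: matrix_vector_mult_basis column_def vec_eq_iff)
qed

lemma matrix_inv_differentiable:
  fixes G :: "real^'k::finite \<Rightarrow> real^'k^'k"
  assumes W: "open W" "z \<in> W" and inv: "\<And>y. y \<in> W \<Longrightarrow> invertible (G y)"
    and d: "\<And>i j. (\<lambda>y. G y $ i $ j) differentiable at z"
  shows "(\<lambda>y. matrix_inv (G y) $ l $ s) differentiable at z"
proof -
  have "(\<lambda>y. det (\<chi> i j. if j = l then axis s 1 $ i else G y $ i $ j)) differentiable at z"
  proof (rule det_differentiable)
    show "(\<lambda>y. (\<chi> i j. if j = l then axis s 1 $ i else G y $ i $ j) $ i $ j) differentiable at z" for i j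
      by (cases "j = l") (simp_all add: d)
  qed
  moreover have "(\<lambda>y. det (G y)) differentiable at z"
    by (rule det_differentiable) (auto intro: d)
  moreover have "det (G z) \<noteq> 0" using inv W invertible_det_nz by blast
  ultimately have "(\<lambda>y. det (\<chi> i j. if j = l then axis s 1 $ i else G y $ i $ j) / det (G y)) differentiable at z"
    by (intro differentiable_divide) auto
  then show ?thesis
    using differentiable_cong_open[OF W] matrix_inv_entry[OF inv] by (metis (no_types, lifting))
qed

lemma christoffel_differentiable:
  fixes G :: "real^'k::finite \<Rightarrow> real^'k^'k"
  assumes W: "open W" "z \<in> W" and inv: "\<And>y. y \<in> W \<Longrightarrow> invertible (G y)"
    and d: "\<And>i j. twice_differentiable W (\<lambda>y. G y $ i $ j)"
  shows "christoffel G l i j differentiable at z"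
proof -
  have *: "(\<lambda>y. G y $ i $ j) differentiable at z" "pd k (\<lambda>y. G y $ i $ j) differentiable at z" for i j k
    using d W unfolding twice_differentiable_def by auto
  have "christoffel G l i j = (\<lambda>x. (\<Sum>s\<in>UNIV. matrix_inv (G x) $ l $ s *
        (pd i (\<lambda>y. G y $ j $ s) x + pd j (\<lambda>y. G y $ i $ s) x - pd s (\<lambda>y. G y $ i $ j) x)) / 2)"
    by (rule ext) (simp add: christoffel_def)
  moreover have "(\<lambda>x. (\<Sum>s\<in>UNIV. matrix_inv (G x) $ l $ s *
        (pd i (\<lambda>y. G y $ j $ s) x + pd j (\<lambda>y. G y $ i $ s) x - pd s (\<lambda>y. G y $ i $ j) x)) / 2)
      differentiable at z"
    by (intro differentiable_divide differentiable_sum ballI differentiable_mult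
      differentiable_diff differentiable_add matrix_inv_differentiable[OF W inv] *) (simp_all add: *)
  ultimately show ?thesis by simp
qed

definition kronecker :: "'k \<Rightarrow> 'k \<Rightarrow> real" where
  "kronecker i j = (if i = j then 1 else 0)"

lemma kronecker_same [simp]: "kronecker i i = 1"
  by (simp add: kronecker_def)

lemma sum_kronecker [simp]:
  fixes j :: "'k::finite"
  shows "(\<Sum>s\<in>UNIV. kronecker s j * u s) = u j" "(\<Sum>s\<in>UNIV. kronecker j s * u s) = u j"
    "(\<Sum>s\<in>UNIV. u s * kronecker s j) = u j" "(\<Sum>s\<in>UNIV. u s * kronecker j s) = u j"
proof -
  have "kronecker s j * u s = (if s = j then u s else 0)" "u s * kronecker s j = (if s = j then u s else 0)"
    "kronecker j s * u s = (if j = s then u s else 0)" "u s * kronecker j s = (if j = s then u s else 0)" for s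
    by (simp_all add: kronecker_def)
  then show "(\<Sum>s\<in>UNIV. kronecker s j * u s) = u j" "(\<Sum>s\<in>UNIV. kronecker j s * u s) = u j"
    "(\<Sum>s\<in>UNIV. u s * kronecker s j) = u j" "(\<Sum>s\<in>UNIV. u s * kronecker j s) = u j"
    by (simp_all only: sum.delta sum.delta' finite UNIV_I if_True)
qed

lemma sum_matrix_inv:
  fixes A :: "real^'k::finite^'k"
  assumes "invertible A"
  shows "(\<Sum>s\<in>UNIV. matrix_inv A $ l $ s * A $ s $ j) = kronecker l j"
    and "(\<Sum>s\<in>UNIV. A $ l $ s * matrix_inv A $ s $ j) = kronecker l j"
  using matrix_inv_right_left[OF assms]
  by (auto simp: matrix_matrix_mult_def mat_def vec_eq_iff kronecker_def)

lemma matrix_inv_scaleR: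
  fixes A :: "real^'k::finite^'k"
  assumes "invertible A" "c \<noteq> 0"
  shows "matrix_inv (c *\<^sub>R A) = (1 / c) *\<^sub>R matrix_inv A"
proof (rule matrix_inv_unique)
  have "A ** (1 / c) *\<^sub>R matrix_inv A = (1 / c) *\<^sub>R (A ** matrix_inv A)"
    by (simp add: matrix_scalar_ac scalar_matrix_assoc)
  then show "c *\<^sub>R A ** (1 / c) *\<^sub>R matrix_inv A = mat 1"
    using assms by (simp add: matrix_inv_right_left flip: scalar_matrix_assoc)
qed

lemma matrix_inv_symmetric:
  fixes A :: "real^'k::finite^'k"
  assumes "invertible A" "\<And>i j. A $ i $ j = A $ j $ i"
  shows "matrix_inv A $ i $ j = matrix_inv A $ j $ i"
proof -
  have t: "transpose A = A" using assms(2) by (simp add: transpose_def vec_eq_iff)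
  have "transpose (matrix_inv A ** A) = mat 1"
    using matrix_inv_right_left(2)[OF assms(1)] by (simp add: transpose_mat)
  then have "A ** transpose (matrix_inv A) = mat 1"
    by (simp add: matrix_transpose_mul t)
  from matrix_inv_unique[OF this]
  have "matrix_inv A $ i $ j = transpose (matrix_inv A) $ i $ j"
    by (rule arg_cong[where f = "\<lambda>B. B $ i $ j"])
  then show ?thesis by (simp add: transpose_def)
qed

text \<open>Raising an index: \<open>v\<close> is the vector metrically dual to the covector \<open>a\<close>.\<close>

lemma contract_matrix_inv:
  fixes A :: "real^'k::finite^'k"
  assumes "invertible A" "\<And>i j. A $ i $ j = A $ j $ i" "\<And>i. (\<Sum>j\<in>UNIV. A $ i $ j * v $ j) = a $ i"
  shows "(\<Sum>l\<in>UNIV. a $ l * matrix_inv A $ l $ s) = v $ s"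
    and "(\<Sum>l\<in>UNIV. matrix_inv A $ s $ l * a $ l) = v $ s"
proof -
  have "(\<Sum>l\<in>UNIV. matrix_inv A $ s $ l * a $ l)
      = (\<Sum>l\<in>UNIV. \<Sum>j\<in>UNIV. matrix_inv A $ s $ l * A $ l $ j * v $ j)"
    by (simp add: assms(3)[symmetric] sum_distrib_left mult.assoc)
  also have "\<dots> = (\<Sum>j\<in>UNIV. (\<Sum>l\<in>UNIV. matrix_inv A $ s $ l * A $ l $ j) * v $ j)"
    by (subst sum.swap) (simp add: sum_distrib_right)
  also have "\<dots> = v $ s" by (simp add: sum_matrix_inv[OF assms(1)])
  finally show 2: "(\<Sum>l\<in>UNIV. matrix_inv A $ s $ l * a $ l) = v $ s" .
  then show "(\<Sum>l\<in>UNIV. a $ l * matrix_inv A $ l $ s) = v $ s"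
    by (simp add: matrix_inv_symmetric[OF assms(1,2), of _ s] mult.commute)
qed

lemma christoffel_cong_open:
  assumes "open W" "z \<in> W" "\<And>y. y \<in> W \<Longrightarrow> G y = G' y"
  shows "christoffel G l i j z = christoffel G' l i j z"
proof -
  have "pd k (\<lambda>y. G y $ i $ j) z = pd k (\<lambda>y. G' y $ i $ j) z" for k i j
    by (rule pd_cong_open[OF assms(1,2)]) (simp add: assms(3))
  then show ?thesis by (simp add: christoffel_def assms)
qed

lemma scalar_curvature_cong_open:
  assumes "open W" "z \<in> W" "\<And>y. y \<in> W \<Longrightarrow> G y = G' y"
  shows "scalar_curvature G z = scalar_curvature G' z"
proof -
  have C: "christoffel G l i j y = christoffel G' l i j y" if "y \<in> W" for l i j y
    by (rule christoffel_cong_open[OF assms(1) that assms(3)])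
  have "pd k (christoffel G l i j) z = pd k (christoffel G' l i j) z" for k l i j
    by (rule pd_cong_open[OF assms(1,2) C])
  then show ?thesis
    by (simp add: scalar_curvature_def ricci_def riemann_def C[OF assms(2)] assms)
qed

lemma hessian_cong_open:
  assumes "open W" "z \<in> W" "\<And>y. y \<in> W \<Longrightarrow> G y = G' y" "\<And>y. y \<in> W \<Longrightarrow> u y = u' y"
  shows "hessian G u z = hessian G' u' z"
proof -
  have p: "pd j u y = pd j u' y" if "y \<in> W" for j y
    by (rule pd_cong_open[OF assms(1) that assms(4)])
  have "pd i (pd j u) z = pd i (pd j u') z" for i j
    by (rule pd_cong_open[OF assms(1,2) p])
  then show ?thesis
    by (simp add: hessian_def p assms(2) christoffel_cong_open[OF assms(1-3)])
qed

section \<open>Conformal change along a parallel gradient\<close>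

text \<open>If the upper index of the Christoffel symbols is contracted with a covector, the inverse of the
  metric disappears in favour of the dual vector.  For \<open>a = dh\<close> this is the first-order
  part of the Hessian.\<close>

lemma christoffel_contract:
  assumes "invertible (G z)" "\<And>i j. G z $ i $ j = G z $ j $ i"
    "\<And>i. (\<Sum>j\<in>UNIV. G z $ i $ j * v $ j) = a $ i"
  shows "(\<Sum>l\<in>UNIV. christoffel G l i j z * a $ l) = (\<Sum>s\<in>UNIV. v $ s *
      (pd i (\<lambda>y. G y $ j $ s) z + pd j (\<lambda>y. G y $ i $ s) z - pd s (\<lambda>y. G y $ i $ j) z)) / 2"
proof -
  let ?e = "\<lambda>s. pd i (\<lambda>y. G y $ j $ s) z + pd j (\<lambda>y. G y $ i $ s) z - pd s (\<lambda>y. G y $ i $ j) z"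
  have "christoffel G l i j z * a $ l = (\<Sum>s\<in>UNIV. a $ l * matrix_inv (G z) $ l $ s * ?e s) / 2" for l
    by (simp only: christoffel_def times_divide_eq_left times_divide_eq_right sum_distrib_left mult_ac)
  then have "(\<Sum>l\<in>UNIV. christoffel G l i j z * a $ l)
     = (\<Sum>l\<in>UNIV. \<Sum>s\<in>UNIV. a $ l * matrix_inv (G z) $ l $ s * ?e s) / 2"
    by (simp only: sum_divide_distrib)
  also have "(\<Sum>l\<in>UNIV. \<Sum>s\<in>UNIV. a $ l * matrix_inv (G z) $ l $ s * ?e s)
     = (\<Sum>s\<in>UNIV. (\<Sum>l\<in>UNIV. a $ l * matrix_inv (G z) $ l $ s) * ?e s)"
    by (subst sum.swap) (simp only: sum_distrib_right)
  finally show ?thesis by (simp add: contract_matrix_inv[OF assms])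
qed

text \<open>The quadratic part of the Ricci tensor under the change of connection \<open>\<Gamma> - T\<close> caused by a
  conformal factor.  The hypotheses on the contractions of \<open>\<Gamma>\<close> say that the covector
  \<open>a\<close> and its dual vector \<open>b\<close>, both with constant components, are parallel; because of them the mixed terms of the two
  products cancel, and only the square of \<open>T\<close> survives.\<close>

lemma conformal_quadratic:
  fixes \<Gamma> :: "'k::finite \<Rightarrow> 'k \<Rightarrow> 'k \<Rightarrow> real"
  assumes sym: "\<And>l i j. \<Gamma> l i j = \<Gamma> l j i"
    and ga: "\<And>i j. (\<Sum>s\<in>UNIV. \<Gamma> s i j * a s) = 0"
    and gb: "\<And>l i. (\<Sum>s\<in>UNIV. \<Gamma> l i s * b s) = 0"
    and gsym: "\<And>i j. g i j = g j i"
    and low: "\<And>i. (\<Sum>s\<in>UNIV. g i s * b s) = a i"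
    and T: "\<And>l i j. T l i j = w * (kronecker l i * a j + kronecker l j * a i - g i j * b l)"
    and q: "q = (\<Sum>s\<in>UNIV. a s * b s)"
  shows "(\<Sum>i\<in>UNIV. \<Sum>s\<in>UNIV. (\<Gamma> i i s - T i i s) * (\<Gamma> s j k - T s j k)
                         - (\<Gamma> i j s - T i j s) * (\<Gamma> s i k - T s i k))
    = (\<Sum>i\<in>UNIV. \<Sum>s\<in>UNIV. \<Gamma> i i s * \<Gamma> s j k - \<Gamma> i j s * \<Gamma> s i k)
      + w\<^sup>2 * (real CARD('k) - 2) * (a j * a k - q * g j k)"
proof -
  define c where "c s = (\<Sum>i\<in>UNIV. \<Gamma> i i s)" for s
  have low': "(\<Sum>s\<in>UNIV. g s i * b s) = a i" for i
    unfolding low[symmetric] by (rule sum.cong) (use gsym in auto)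
  have c': "c s = (\<Sum>i\<in>UNIV. \<Gamma> i s i)" for s
    unfolding c_def by (intro sum.cong refl sym)
  have q': "(\<Sum>s\<in>UNIV. b s * a s) = q" by (simp add: q mult.commute)
  have cb: "(\<Sum>s\<in>UNIV. c s * b s) = 0"
    unfolding c_def sum_distrib_right by (subst sum.swap) (simp add: gb)
  have trace: "(\<Sum>i\<in>UNIV. T i i s) = w * real CARD('k) * a s" for s
  proof -
    have "(\<Sum>i\<in>UNIV. T i i s) = (\<Sum>i\<in>UNIV. w * (a s + kronecker i s * a i - g i s * b i))"
      by (simp add: T)
    also have "\<dots> = w * (real CARD('k) * a s + a s - a s)"
      by (simp only: sum_distrib_left[symmetric] sum.distrib sum_subtractf low' sum_kronecker sum_constant)
    finally show ?thesis by simp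
  qed
  have contr: "(\<Sum>s\<in>UNIV. u s * T s j k)
      = w * (u j * a k + u k * a j - g j k * (\<Sum>s\<in>UNIV. u s * b s))" for u j k
  proof -
    have "(\<Sum>s\<in>UNIV. u s * T s j k)
       = (\<Sum>s\<in>UNIV. w * (kronecker s j * (u s * a k) + kronecker s k * (u s * a j) - g j k * (u s * b s)))"
      by (intro sum.cong refl) (simp add: T algebra_simps)
    then show ?thesis
      by (simp add: sum_distrib_left[symmetric] sum.distrib sum_subtractf)
  qed
  have 1: "(\<Sum>i\<in>UNIV. \<Sum>s\<in>UNIV. (\<Gamma> i i s - T i i s) * (\<Gamma> s j k - T s j k))
     = (\<Sum>i\<in>UNIV. \<Sum>s\<in>UNIV. \<Gamma> i i s * \<Gamma> s j k) - w * (c j * a k + c k * a j)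
       + w\<^sup>2 * real CARD('k) * (2 * a j * a k - g j k * q)"
  proof -
    have "(\<Sum>i\<in>UNIV. \<Sum>s\<in>UNIV. (\<Gamma> i i s - T i i s) * (\<Gamma> s j k - T s j k))
       = (\<Sum>s\<in>UNIV. (c s - w * real CARD('k) * a s) * (\<Gamma> s j k - T s j k))"
      by (subst sum.swap) (simp add: c_def sum_subtractf sum_distrib_right[symmetric] trace)
    also have "\<dots> = (\<Sum>s\<in>UNIV. c s * \<Gamma> s j k) - (\<Sum>s\<in>UNIV. c s * T s j k)
        - w * real CARD('k) * (\<Sum>s\<in>UNIV. \<Gamma> s j k * a s) + w * real CARD('k) * (\<Sum>s\<in>UNIV. a s * T s j k)"
      by (simp add: sum_distrib_left sum_subtractf sum.distrib algebra_simps)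
    also have "(\<Sum>s\<in>UNIV. c s * \<Gamma> s j k) = (\<Sum>i\<in>UNIV. \<Sum>s\<in>UNIV. \<Gamma> i i s * \<Gamma> s j k)"
      unfolding c_def sum_distrib_right by (rule sum.swap)
    finally show ?thesis
      unfolding contr ga cb q[symmetric] by (simp add: power2_eq_square algebra_simps)
  qed
  have 2: "(\<Sum>i\<in>UNIV. \<Sum>s\<in>UNIV. \<Gamma> i j s * T s i k) = w * (c j * a k)"
  proof -
    have "(\<Sum>i\<in>UNIV. \<Sum>s\<in>UNIV. \<Gamma> i j s * T s i k)
        = w * (\<Sum>i\<in>UNIV. \<Gamma> i j i * a k + \<Gamma> i j k * a i)"
      by (simp add: contr gb sum_distrib_left)
    also have "\<dots> = w * (c j * a k)"
      by (simp add: sum.distrib ga c' sum_distrib_right)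
    finally show ?thesis .
  qed
  have 3: "(\<Sum>i\<in>UNIV. \<Sum>s\<in>UNIV. T i j s * \<Gamma> s i k) = w * (c k * a j)"
  proof -
    have "(\<Sum>i\<in>UNIV. \<Sum>s\<in>UNIV. T i j s * \<Gamma> s i k) = (\<Sum>s\<in>UNIV. \<Sum>i\<in>UNIV. \<Gamma> s k i * T i j s)"
      by (subst sum.swap) (intro sum.cong refl, subst sym, rule mult.commute)
    also have "\<dots> = w * (\<Sum>s\<in>UNIV. \<Gamma> s k j * a s + \<Gamma> s k s * a j)"
      by (simp add: contr gb sum_distrib_left)
    also have "\<dots> = w * (c k * a j)"
      by (simp add: sum.distrib ga c' sum_distrib_right)
    finally show ?thesis .
  qed
  have 4: "(\<Sum>i\<in>UNIV. \<Sum>s\<in>UNIV. T i j s * T s i k)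
      = w\<^sup>2 * ((real CARD('k) + 2) * a j * a k - 2 * g j k * q)"
  proof -
    have g1: "(\<Sum>s\<in>UNIV. T i j s * b s) = w * (kronecker i j * q)" for i
    proof -
      have "(\<Sum>s\<in>UNIV. T i j s * b s)
         = w * (\<Sum>s\<in>UNIV. kronecker i j * (a s * b s) + a j * (kronecker i s * b s) - b i * (g j s * b s))"
        unfolding sum_distrib_left by (intro sum.cong refl) (simp add: T algebra_simps)
      also have "\<dots> = w * (kronecker i j * q + a j * b i - b i * a j)"
        by (simp only: sum.distrib sum_subtractf sum_distrib_left[symmetric] sum_kronecker low q)
      finally show ?thesis by simp
    qed
    have g2: "T i j i = w * (kronecker i j * a i + a j - g j i * b i)" for i by (simp add: T)
    have g3: "(\<Sum>i\<in>UNIV. a i * T i j k) = w * (2 * a j * a k - g j k * q)"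
      using contr[of a j k] by (simp add: q mult_ac)
    have "(\<Sum>i\<in>UNIV. \<Sum>s\<in>UNIV. T i j s * T s i k)
       = w * (\<Sum>i\<in>UNIV. T i j i * a k + T i j k * a i - g i k * (w * (kronecker i j * q)))"
      by (simp add: contr g1 sum_distrib_left)
    also have "\<dots> = w * ((\<Sum>i\<in>UNIV. T i j i) * a k + w * (2 * a j * a k - g j k * q)
         - w * q * (\<Sum>i\<in>UNIV. g i k * kronecker i j))"
      by (simp only: sum.distrib sum_subtractf g3 sum_distrib_left sum_distrib_right mult_ac)
    also have "(\<Sum>i\<in>UNIV. T i j i) = w * real CARD('k) * a j"
      by (simp add: g2 sum_distrib_left[symmetric] sum.distrib sum_subtractf low)
    finally show ?thesis by (simp add: power2_eq_square algebra_simps)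
  qed
  have "(\<Sum>i\<in>UNIV. \<Sum>s\<in>UNIV. (\<Gamma> i i s - T i i s) * (\<Gamma> s j k - T s j k)
                         - (\<Gamma> i j s - T i j s) * (\<Gamma> s i k - T s i k))
     = (\<Sum>i\<in>UNIV. \<Sum>s\<in>UNIV. (\<Gamma> i i s - T i i s) * (\<Gamma> s j k - T s j k))
       - ((\<Sum>i\<in>UNIV. \<Sum>s\<in>UNIV. \<Gamma> i j s * \<Gamma> s i k) - (\<Sum>i\<in>UNIV. \<Sum>s\<in>UNIV. \<Gamma> i j s * T s i k)
          - (\<Sum>i\<in>UNIV. \<Sum>s\<in>UNIV. T i j s * \<Gamma> s i k) + (\<Sum>i\<in>UNIV. \<Sum>s\<in>UNIV. T i j s * T s i k))"
    by (simp only: sum_subtractf[symmetric] sum.distrib[symmetric]) (simp add: algebra_simps)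
  then show ?thesis
    unfolding 1 2 3 4 sum_subtractf by (simp add: algebra_simps power2_eq_square)
qed

text \<open>A metric together with a linear coordinate function \<open>lin_form a\<close> whose gradient \<open>b\<close>
  has constant components and is a Killing field.  A Killing field that is a gradient is
  parallel, which is what \<open>christoffel_covector\<close> and \<open>christoffel_vector\<close> express.\<close>

locale parallel_gradient =
  fixes G :: "real^'k::finite \<Rightarrow> real^'k^'k" and W :: "(real^'k) set" and a b :: "real^'k"
  assumes open_W: "open W"
    and symmetric: "z \<in> W \<Longrightarrow> G z $ i $ j = G z $ j $ i"
    and nondegenerate: "z \<in> W \<Longrightarrow> invertible (G z)"
    and twice: "twice_differentiable W (\<lambda>z. G z $ i $ j)"
    and lower: "z \<in> W \<Longrightarrow> (\<Sum>j\<in>UNIV. G z $ i $ j * b $ j) = a $ i"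
    and killing: "z \<in> W \<Longrightarrow> (\<Sum>s\<in>UNIV. b $ s * pd s (\<lambda>y. G y $ i $ j) z) = 0"
begin

lemma entry_differentiable: "z \<in> W \<Longrightarrow> (\<lambda>y. G y $ i $ j) differentiable at z"
  using twice unfolding twice_differentiable_def by blast

lemma christoffel_is_differentiable: "z \<in> W \<Longrightarrow> christoffel G l i j differentiable at z"
  using christoffel_differentiable open_W nondegenerate twice by blast

lemma pd_symmetric: "z \<in> W \<Longrightarrow> pd k (\<lambda>y. G y $ i $ j) z = pd k (\<lambda>y. G y $ j $ i) z"
  using pd_cong_open[OF open_W] symmetric by (metis (no_types, lifting))

lemma christoffel_symmetric: "z \<in> W \<Longrightarrow> christoffel G l i j z = christoffel G l j i z"
  unfolding christoffel_def by (simp add: pd_symmetric[of z _ i j] add.commute)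

lemma pd_lower:
  assumes "z \<in> W"
  shows "(\<Sum>s\<in>UNIV. b $ s * pd k (\<lambda>y. G y $ j $ s) z) = 0"
proof -
  have "pd k (\<lambda>y. \<Sum>s\<in>UNIV. G y $ j $ s * b $ s) z = (\<Sum>s\<in>UNIV. b $ s * pd k (\<lambda>y. G y $ j $ s) z)"
    using entry_differentiable[OF assms] by (subst pd_sum) (auto simp: pd_mult mult.commute)
  moreover have "pd k (\<lambda>y. \<Sum>s\<in>UNIV. G y $ j $ s * b $ s) z = pd k (\<lambda>y. a $ j) z"
    by (rule pd_cong_open[OF open_W assms lower])
  ultimately show ?thesis by simp
qed

lemma christoffel_covector:
  assumes "z \<in> W"
  shows "(\<Sum>l\<in>UNIV. christoffel G l i j z * a $ l) = 0"
proof -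
  have "(\<Sum>l\<in>UNIV. christoffel G l i j z * a $ l) = (\<Sum>s\<in>UNIV. b $ s *
      (pd i (\<lambda>y. G y $ j $ s) z + pd j (\<lambda>y. G y $ i $ s) z - pd s (\<lambda>y. G y $ i $ j) z)) / 2"
    by (rule christoffel_contract) (use assms nondegenerate symmetric lower in auto)
  also have "\<dots> = 0"
    by (simp add: distrib_left right_diff_distrib sum.distrib sum_subtractf pd_lower killing assms)
  finally show ?thesis .
qed

lemma christoffel_vector:
  assumes "z \<in> W"
  shows "(\<Sum>s\<in>UNIV. christoffel G l i s z * b $ s) = 0"
proof -
  let ?e = "\<lambda>s r. pd i (\<lambda>y. G y $ s $ r) z + pd s (\<lambda>y. G y $ i $ r) z - pd r (\<lambda>y. G y $ i $ s) z"
  have "(\<Sum>s\<in>UNIV. christoffel G l i s z * b $ s)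
     = (\<Sum>s\<in>UNIV. \<Sum>r\<in>UNIV. matrix_inv (G z) $ l $ r * (b $ s * ?e s r)) / 2"
    by (simp only: christoffel_def times_divide_eq_left times_divide_eq_right sum_distrib_left sum_divide_distrib mult_ac)
  also have "(\<Sum>s\<in>UNIV. \<Sum>r\<in>UNIV. matrix_inv (G z) $ l $ r * (b $ s * ?e s r))
     = (\<Sum>r\<in>UNIV. matrix_inv (G z) $ l $ r * (\<Sum>s\<in>UNIV. b $ s * ?e s r))"
    by (subst sum.swap) (simp only: sum_distrib_left)
  also have "\<dots> = 0"
  proof -
    have "(\<Sum>s\<in>UNIV. b $ s * ?e s r) = 0" for r
    proof -
      have "(\<Sum>s\<in>UNIV. b $ s * pd i (\<lambda>y. G y $ s $ r) z) = (\<Sum>s\<in>UNIV. b $ s * pd i (\<lambda>y. G y $ r $ s) z)"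
        by (intro sum.cong refl) (simp only: pd_symmetric[OF assms, of _ _ r])
      then show ?thesis
        by (simp add: distrib_left right_diff_distrib sum.distrib sum_subtractf pd_lower killing assms)
    qed
    then show ?thesis by (simp only:) simp
  qed
  finally show ?thesis by simp
qed

end

text \<open>The metric is divided by \<open>\<phi>\<^sup>2\<close>, where \<open>\<phi>\<close> depends on \<open>lin_form a\<close> only.  The change of the
  connection is governed by the logarithmic derivative \<open>\<omega>\<close> of \<open>\<phi>\<close>.\<close>

locale conformal_change = parallel_gradient G W a b
  for G :: "real^'k::finite \<Rightarrow> real^'k^'k" and W a b +
  fixes J :: "real set" and \<phi> \<phi>' \<phi>'' :: "real \<Rightarrow> real"
  assumes range_J: "z \<in> W \<Longrightarrow> lin_form a z \<in> J"
    and nz: "t \<in> J \<Longrightarrow> \<phi> t \<noteq> 0"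
    and d1: "t \<in> J \<Longrightarrow> (\<phi> has_real_derivative \<phi>' t) (at t)"
    and d2: "t \<in> J \<Longrightarrow> (\<phi>' has_real_derivative \<phi>'' t) (at t)"
begin

abbreviation "G1 \<equiv> \<lambda>z. (1 / (\<phi> (lin_form a z))\<^sup>2) *\<^sub>R G z"
abbreviation "\<omega> \<equiv> \<lambda>t. \<phi>' t / \<phi> t"
abbreviation "\<omega>' \<equiv> \<lambda>t. \<phi>'' t / \<phi> t - (\<phi>' t / \<phi> t)\<^sup>2"

lemma factor_derivative:
  assumes "t \<in> J"
  shows "((\<lambda>t. 1 / (\<phi> t)\<^sup>2) has_real_derivative - 2 * \<omega> t * (1 / (\<phi> t)\<^sup>2)) (at t)"
  by (rule derivative_eq_intros d1 assms refl | use nz assms in force)+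
     (use nz[OF assms] in \<open>simp add: field_simps power2_eq_square power3_eq_cube\<close>)

lemma log_derivative:
  assumes "t \<in> J"
  shows "(\<omega> has_real_derivative \<omega>' t) (at t)"
  by (rule derivative_eq_intros d1 d2 assms refl nz)+
     (use nz[OF assms] in \<open>simp add: field_simps power2_eq_square\<close>)

lemma pd_conformal:
  assumes "z \<in> W"
  shows "pd k (\<lambda>y. G1 y $ i $ j) z = (1 / (\<phi> (lin_form a z))\<^sup>2) *
     (pd k (\<lambda>y. G y $ i $ j) z - 2 * \<omega> (lin_form a z) * a $ k * G z $ i $ j)"
proof -
  note d = factor_derivative[OF range_J[OF assms]]
  have "pd k (\<lambda>y. 1 / (\<phi> (lin_form a y))\<^sup>2 * G y $ i $ j) z
     = (- 2 * \<omega> (lin_form a z) * (1 / (\<phi> (lin_form a z))\<^sup>2) * a $ k) * G z $ i $ j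
       + 1 / (\<phi> (lin_form a z))\<^sup>2 * pd k (\<lambda>y. G y $ i $ j) z"
    by (subst pd_mult[OF differentiable_lin_form[OF d] entry_differentiable[OF assms]])
       (simp only: pd_lin_form[OF d])
  then show ?thesis by (simp add: algebra_simps)
qed

lemma christoffel_conformal:
  assumes "z \<in> W"
  shows "christoffel G1 l i j z = christoffel G l i j z
     - \<omega> (lin_form a z) * (kronecker l i * a $ j + kronecker l j * a $ i - G z $ i $ j * b $ l)"
proof -
  let ?w = "\<omega> (lin_form a z)" and ?p = "(\<phi> (lin_form a z))\<^sup>2" and ?M = "matrix_inv (G z)"
  let ?e = "\<lambda>s. pd i (\<lambda>y. G y $ j $ s) z + pd j (\<lambda>y. G y $ i $ s) z - pd s (\<lambda>y. G y $ i $ j) z"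
  have p: "?p \<noteq> 0" using nz range_J assms by simp
  have M: "matrix_inv (G1 z) = ?p *\<^sub>R ?M"
    using matrix_inv_scaleR[OF nondegenerate[OF assms], of "1 / ?p"] p by simp
  have "christoffel G1 l i j z = (\<Sum>s\<in>UNIV. ?p * ?M $ l $ s * (1 / ?p * (?e s
      - 2 * ?w * (a $ i * G z $ j $ s + a $ j * G z $ i $ s - a $ s * G z $ i $ j)))) / 2"
    unfolding christoffel_def pd_conformal[OF assms] M
    by (intro arg_cong[where f = "\<lambda>x. x / 2"] sum.cong refl) (simp add: algebra_simps)
  also have "\<dots> = (\<Sum>s\<in>UNIV. ?M $ l $ s * ?e s / 2
      - ?w * (a $ i * (?M $ l $ s * G z $ s $ j) + a $ j * (?M $ l $ s * G z $ s $ i)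
           - G z $ i $ j * (?M $ l $ s * a $ s)))"
    unfolding sum_divide_distrib
  proof (intro sum.cong refl)
    fix s
    have G: "G z $ j $ s = G z $ s $ j" "G z $ i $ s = G z $ s $ i"
      by (rule symmetric[OF assms])+
    have cancel: "(P * m) * (1 / P * (e - 2 * w * (u + v - x))) / 2 = m * e / 2 - w * (m * u + m * v - m * x)"
      if "P \<noteq> 0" for P m e w u v x :: real
      using that by (simp add: field_simps)
    show "?p * ?M $ l $ s * (1 / ?p * (?e s
      - 2 * ?w * (a $ i * G z $ j $ s + a $ j * G z $ i $ s - a $ s * G z $ i $ j))) / 2
      = ?M $ l $ s * ?e s / 2
      - ?w * (a $ i * (?M $ l $ s * G z $ s $ j) + a $ j * (?M $ l $ s * G z $ s $ i)
           - G z $ i $ j * (?M $ l $ s * a $ s))"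
      unfolding G cancel[OF p] by (simp only: mult_ac)
  qed
  also have "\<dots> = christoffel G l i j z - ?w * (a $ i * (\<Sum>s\<in>UNIV. ?M $ l $ s * G z $ s $ j)
      + a $ j * (\<Sum>s\<in>UNIV. ?M $ l $ s * G z $ s $ i) - G z $ i $ j * (\<Sum>s\<in>UNIV. ?M $ l $ s * a $ s))"
    unfolding christoffel_def
    by (simp only: sum_subtractf sum.distrib sum_distrib_left[symmetric] sum_divide_distrib[symmetric])
  also have "(\<Sum>s\<in>UNIV. ?M $ l $ s * a $ s) = b $ l"
    by (rule contract_matrix_inv(2)) (use assms nondegenerate symmetric lower in auto)
  finally show ?thesis
    unfolding sum_matrix_inv(1)[OF nondegenerate[OF assms]] by (simp add: algebra_simps)
qed

lemma pd_christoffel_conformal: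
  assumes "z \<in> W"
  shows "pd r (christoffel G1 l i j) z = pd r (christoffel G l i j) z
     - (\<omega>' (lin_form a z) * a $ r * (kronecker l i * a $ j + kronecker l j * a $ i - G z $ i $ j * b $ l)
        - \<omega> (lin_form a z) * (pd r (\<lambda>y. G y $ i $ j) z * b $ l))"
proof -
  note d = log_derivative[OF range_J[OF assms]]
  note dG = entry_differentiable[OF assms]
  let ?T = "\<lambda>y. kronecker l i * a $ j + kronecker l j * a $ i - G y $ i $ j * b $ l"
  have dT: "?T differentiable at z"
    by (intro differentiable_diff differentiable_const differentiable_mult dG)
  have pT: "pd r ?T z = - (pd r (\<lambda>y. G y $ i $ j) z * b $ l)"
    by (subst pd_diff) (auto simp: pd_mult dG)
  have "pd r (christoffel G1 l i j) z
      = pd r (\<lambda>y. christoffel G l i j y - \<omega> (lin_form a y) * ?T y) z"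
    by (rule pd_cong_open[OF open_W assms christoffel_conformal])
  also have "\<dots> = pd r (christoffel G l i j) z - pd r (\<lambda>y. \<omega> (lin_form a y) * ?T y) z"
    by (rule pd_diff[OF christoffel_is_differentiable[OF assms] differentiable_mult[OF differentiable_lin_form[OF d] dT]])
  also have "pd r (\<lambda>y. \<omega> (lin_form a y) * ?T y) z
      = \<omega>' (lin_form a z) * a $ r * ?T z + \<omega> (lin_form a z) * pd r ?T z"
    by (subst pd_mult[OF differentiable_lin_form[OF d] dT]) (simp only: pd_lin_form[OF d])
  finally show ?thesis by (simp add: pT)
qed

text \<open>The Hessian of \<open>lin_form a\<close> vanishes because its gradient is parallel.  Therefore the
  second-order terms of the general conformal transformation law reduce to the ordinary
  derivative of \<open>\<omega>\<close>.\<close>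

lemma ricci_conformal:
  assumes "z \<in> W"
  defines "t \<equiv> lin_form a z" and "q \<equiv> \<Sum>i\<in>UNIV. a $ i * b $ i"
  shows "ricci G1 j k z = ricci G j k z
     + (real CARD('k) - 2) * (\<omega>' t + (\<omega> t)\<^sup>2) * (a $ j * a $ k)
     + (\<omega>' t - (real CARD('k) - 2) * (\<omega> t)\<^sup>2) * q * G z $ j $ k"
proof -
  define \<Gamma> where "\<Gamma> l i j = christoffel G l i j z" for l i j
  define T where "T l i j = \<omega> t * (kronecker l i * a $ j + kronecker l j * a $ i - G z $ i $ j * b $ l)" for l i j
  let ?dG = "\<lambda>r i j. pd r (\<lambda>y. G y $ i $ j) z"
  have C: "christoffel G1 l i j z = \<Gamma> l i j - T l i j" for l i j
    unfolding \<Gamma>_def T_def t_def by (rule christoffel_conformal[OF assms(1)])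
  have D: "pd r (christoffel G1 l i j) z = pd r (christoffel G l i j) z
     - (\<omega>' t * a $ r * (kronecker l i * a $ j + kronecker l j * a $ i - G z $ i $ j * b $ l) - \<omega> t * (?dG r i j * b $ l))"
    for r l i j unfolding t_def by (rule pd_christoffel_conformal[OF assms(1)])
  have quad: "(\<Sum>i\<in>UNIV. \<Sum>s\<in>UNIV. (\<Gamma> i i s - T i i s) * (\<Gamma> s j k - T s j k)
                         - (\<Gamma> i j s - T i j s) * (\<Gamma> s i k - T s i k))
    = (\<Sum>i\<in>UNIV. \<Sum>s\<in>UNIV. \<Gamma> i i s * \<Gamma> s j k - \<Gamma> i j s * \<Gamma> s i k)
      + (\<omega> t)\<^sup>2 * (real CARD('k) - 2) * (a $ j * a $ k - q * G z $ j $ k)"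
    by (rule conformal_quadratic[where b = "($) b"])
       (use assms(1) in \<open>simp_all add: \<Gamma>_def T_def q_def lower symmetric christoffel_symmetric
          christoffel_covector christoffel_vector\<close>)
  have low: "(\<Sum>i\<in>UNIV. G z $ k $ i * b $ i) = a $ k" for k by (rule lower[OF assms(1)])
  have d1: "(\<Sum>i\<in>UNIV. \<omega>' t * a $ i * (kronecker i j * a $ k + kronecker i k * a $ j - G z $ j $ k * b $ i)
        - \<omega> t * (?dG i j k * b $ i)) = \<omega>' t * (2 * (a $ j * a $ k) - q * G z $ j $ k)"
  proof -
    have "(\<Sum>i\<in>UNIV. \<omega>' t * a $ i * (kronecker i j * a $ k + kronecker i k * a $ j - G z $ j $ k * b $ i)
        - \<omega> t * (?dG i j k * b $ i))
      = (\<Sum>i\<in>UNIV. \<omega>' t * (a $ k * (kronecker i j * a $ i) + a $ j * (kronecker i k * a $ i) - G z $ j $ k * (a $ i * b $ i))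
        - \<omega> t * (b $ i * ?dG i j k))"
      by (intro sum.cong refl) (simp add: algebra_simps)
    also have "\<dots> = \<omega>' t * (a $ k * a $ j + a $ j * a $ k - G z $ j $ k * q) - \<omega> t * 0"
      by (simp only: sum_subtractf sum.distrib sum_distrib_left[symmetric] sum_kronecker q_def killing[OF assms(1)])
    finally show ?thesis by (simp add: algebra_simps)
  qed
  have d2: "(\<Sum>i\<in>UNIV. \<omega>' t * a $ j * (kronecker i i * a $ k + kronecker i k * a $ i - G z $ i $ k * b $ i)
        - \<omega> t * (?dG j i k * b $ i)) = \<omega>' t * (real CARD('k) * (a $ j * a $ k))"
  proof -
    have "(\<Sum>i\<in>UNIV. \<omega>' t * a $ j * (kronecker i i * a $ k + kronecker i k * a $ i - G z $ i $ k * b $ i)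
        - \<omega> t * (?dG j i k * b $ i))
      = (\<Sum>i\<in>UNIV. \<omega>' t * a $ j * (a $ k + kronecker i k * a $ i - G z $ k $ i * b $ i)
        - \<omega> t * (b $ i * ?dG j k i))"
    proof (intro sum.cong refl)
      fix i
      have G: "G z $ i $ k = G z $ k $ i" "?dG j i k = ?dG j k i"
        using symmetric pd_symmetric assms(1) by blast+
      show "\<omega>' t * a $ j * (kronecker i i * a $ k + kronecker i k * a $ i - G z $ i $ k * b $ i)
          - \<omega> t * (?dG j i k * b $ i)
        = \<omega>' t * a $ j * (a $ k + kronecker i k * a $ i - G z $ k $ i * b $ i) - \<omega> t * (b $ i * ?dG j k i)"
        unfolding G by (simp add: mult.commute)
    qed
    also have "\<dots> = \<omega>' t * a $ j * (real CARD('k) * a $ k + a $ k - a $ k) - \<omega> t * 0"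
      by (simp only: sum_subtractf sum.distrib sum_distrib_left[symmetric] sum_kronecker low
          pd_lower[OF assms(1)] sum_constant)
    finally show ?thesis by simp
  qed
  have "ricci G1 j k z = (\<Sum>i\<in>UNIV. pd i (christoffel G i j k) z - pd j (christoffel G i i k) z)
     - (\<Sum>i\<in>UNIV. \<omega>' t * a $ i * (kronecker i j * a $ k + kronecker i k * a $ j - G z $ j $ k * b $ i) - \<omega> t * (?dG i j k * b $ i))
     + (\<Sum>i\<in>UNIV. \<omega>' t * a $ j * (kronecker i i * a $ k + kronecker i k * a $ i - G z $ i $ k * b $ i) - \<omega> t * (?dG j i k * b $ i))
     + (\<Sum>i\<in>UNIV. \<Sum>s\<in>UNIV. (\<Gamma> i i s - T i i s) * (\<Gamma> s j k - T s j k)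
                         - (\<Gamma> i j s - T i j s) * (\<Gamma> s i k - T s i k))"
    unfolding ricci_def riemann_def C D
    by (simp only: sum.distrib[symmetric] sum_subtractf[symmetric]) (intro sum.cong refl, simp only: algebra_simps)
  moreover have "ricci G j k z = (\<Sum>i\<in>UNIV. pd i (christoffel G i j k) z - pd j (christoffel G i i k) z)
     + (\<Sum>i\<in>UNIV. \<Sum>s\<in>UNIV. \<Gamma> i i s * \<Gamma> s j k - \<Gamma> i j s * \<Gamma> s i k)"
    unfolding ricci_def riemann_def \<Gamma>_def by (simp only: sum.distrib)
  ultimately show ?thesis unfolding d1 d2 quad by (simp only:) (simp only: algebra_simps)
qed

text \<open>The trace of \<open>ricci_conformal\<close>, with \<open>\<omega>' + \<omega>\<^sup>2 = \<phi>''/\<phi>\<close>.\<close>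

lemma scalar_curvature_conformal:
  assumes "z \<in> W"
  defines "t \<equiv> lin_form a z" and "q \<equiv> \<Sum>i\<in>UNIV. a $ i * b $ i"
  shows "scalar_curvature G1 z = (\<phi> t)\<^sup>2 * scalar_curvature G z
     + (real CARD('k) - 1) * (2 * \<phi> t * \<phi>'' t - real CARD('k) * (\<phi>' t)\<^sup>2) * q"
proof -
  let ?M = "matrix_inv (G z)" and ?N = "real CARD('k)"
  have p: "\<phi> t \<noteq> 0" using nz range_J assms by simp
  have M: "matrix_inv (G1 z) = (\<phi> t)\<^sup>2 *\<^sub>R ?M"
    using matrix_inv_scaleR[OF nondegenerate[OF assms(1)], of "1 / (\<phi> t)\<^sup>2"] p by (simp add: t_def)
  define c1 where "c1 = (?N - 2) * (\<omega>' t + (\<omega> t)\<^sup>2)"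
  define c2 where "c2 = (\<omega>' t - (?N - 2) * (\<omega> t)\<^sup>2) * q"
  have R: "ricci G1 j k z = ricci G j k z + c1 * (a $ j * a $ k) + c2 * G z $ j $ k" for j k
    unfolding c1_def c2_def t_def q_def by (rule ricci_conformal[OF assms(1)])
  have Mb: "(\<Sum>k\<in>UNIV. ?M $ j $ k * a $ k) = b $ j" for j
    by (rule contract_matrix_inv(2)) (use assms nondegenerate symmetric lower in auto)
  have Maa: "(\<Sum>j\<in>UNIV. \<Sum>k\<in>UNIV. ?M $ j $ k * (a $ j * a $ k)) = q"
  proof -
    have "(\<Sum>k\<in>UNIV. ?M $ j $ k * (a $ j * a $ k)) = a $ j * (\<Sum>k\<in>UNIV. ?M $ j $ k * a $ k)" for j
      by (simp only: sum_distrib_left mult_ac)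
    then show ?thesis by (simp add: Mb q_def)
  qed
  have MG: "(\<Sum>j\<in>UNIV. \<Sum>k\<in>UNIV. ?M $ j $ k * G z $ j $ k) = ?N"
  proof -
    have "(\<Sum>k\<in>UNIV. ?M $ j $ k * G z $ j $ k) = (\<Sum>k\<in>UNIV. ?M $ j $ k * G z $ k $ j)" for j
      by (intro sum.cong refl) (simp only: symmetric[OF assms(1), of j])
    then show ?thesis by (simp add: sum_matrix_inv[OF nondegenerate[OF assms(1)]])
  qed
  have "scalar_curvature G1 z = (\<phi> t)\<^sup>2 * (\<Sum>j\<in>UNIV. \<Sum>k\<in>UNIV. ?M $ j $ k * ricci G j k z
      + c1 * (?M $ j $ k * (a $ j * a $ k)) + c2 * (?M $ j $ k * G z $ j $ k))"
    unfolding scalar_curvature_def M R sum_distrib_left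
    by (intro sum.cong refl) (simp add: algebra_simps)
  also have "\<dots> = (\<phi> t)\<^sup>2 * (scalar_curvature G z + c1 * q + c2 * ?N)"
    by (simp only: sum.distrib sum_distrib_left[symmetric] Maa MG scalar_curvature_def)
  also have "\<dots> = (\<phi> t)\<^sup>2 * scalar_curvature G z
     + (?N - 1) * (2 * \<phi> t * \<phi>'' t - ?N * (\<phi>' t)\<^sup>2) * q"
    unfolding c1_def c2_def using p by (simp add: field_simps power2_eq_square)
  finally show ?thesis .
qed

end

section \<open>Products with a constant metric\<close>

lemma sum_UNIV_Plus:
  fixes u :: "'n::finite + 'm::finite \<Rightarrow> 'a::comm_monoid_add"
  shows "(\<Sum>k\<in>UNIV. u k) = (\<Sum>i\<in>UNIV. u (Inl i)) + (\<Sum>j\<in>UNIV. u (Inr j))"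
  unfolding UNIV_Plus_UNIV[symmetric] by (subst sum.Plus) (auto simp: comp_def)

lemma vec_join_nth [simp]: "vec_join x y $ Inl i = x $ i" "vec_join x y $ Inr j = y $ j"
  by (simp_all add: vec_join_def)

lemma vec_fst_join [simp]: "vec_fst (vec_join x y) = x"
  and vec_snd_join [simp]: "vec_snd (vec_join x y) = y"
  by (simp_all add: vec_fst_def vec_snd_def vec_eq_iff)

lemma vec_join_fst_snd [simp]: "vec_join (vec_fst z) (vec_snd z) = z"
  by (simp add: vec_join_def vec_fst_def vec_snd_def vec_eq_iff split: sum.split)

lemma bounded_linear_vec_fst: "bounded_linear vec_fst"
  unfolding vec_fst_def linear_conv_bounded_linear[symmetric] by (auto intro!: linearI simp: vec_eq_iff)

lemma bounded_linear_vec_snd: "bounded_linear vec_snd"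
  unfolding vec_snd_def linear_conv_bounded_linear[symmetric] by (auto intro!: linearI simp: vec_eq_iff)

lemma lin_form_vec_fst: "lin_form a (vec_fst z) = lin_form (vec_join a 0) z"
  by (simp add: lin_form_def sum_UNIV_Plus vec_fst_def)

lemma open_vec_fst_snd:
  assumes "open S" "open R"
  shows "open {z. vec_fst z \<in> S \<and> vec_snd z \<in> R}"
proof -
  have "open (vec_fst -` S)" "open (vec_snd -` R)"
    using assms bounded_linear_vec_fst bounded_linear_vec_snd
    by (auto intro!: open_vimage linear_continuous_on)
  then show ?thesis by (auto simp: vimage_def intro: open_Collect_conj)
qed

lemma vec_snd_axis [simp]: "vec_snd (axis (Inl i) 1) = 0" "vec_snd (axis (Inr j) 1) = axis j 1"
  by (auto simp: vec_snd_def axis_def vec_eq_iff)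

lemma has_derivative_vec_snd:
  assumes "u differentiable at (vec_snd z)"
  shows "((\<lambda>z. u (vec_snd z)) has_derivative (\<lambda>v. frechet_derivative u (at (vec_snd z)) (vec_snd v))) (at z)"
  using has_derivative_compose[OF bounded_linear_imp_has_derivative[OF bounded_linear_vec_snd]]
    assms[unfolded frechet_derivative_works] by blast

lemma pd_vec_snd:
  assumes "u differentiable at (vec_snd z)"
  shows "pd (Inl i) (\<lambda>z. u (vec_snd z)) z = 0"
    and "pd (Inr j) (\<lambda>z. u (vec_snd z)) z = pd j u (vec_snd z)"
  using pd_eqI[OF has_derivative_vec_snd[OF assms]] linear_frechet_derivative[OF assms]
  by (simp_all add: linear_0 pd_def)

lemma differentiable_vec_snd:
  "u differentiable at (vec_snd z) \<Longrightarrow> (\<lambda>z. u (vec_snd z)) differentiable at z"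
  using has_derivative_vec_snd differentiableI by blast

lemma block_diag_nth [simp]:
  "block_diag P Q $ Inl i $ Inl j = P $ i $ j" "block_diag P Q $ Inl i $ Inr j' = 0"
  "block_diag P Q $ Inr i' $ Inl j = 0" "block_diag P Q $ Inr i' $ Inr j' = Q $ i' $ j'"
  by (simp_all add: block_diag_def)

lemma block_diag_eqI:
  fixes A :: "real^('n::finite + 'm::finite)^('n + 'm)"
  assumes "\<And>i j. A $ Inl i $ Inl j = P $ i $ j" "\<And>i j. A $ Inl i $ Inr j = 0"
    "\<And>i j. A $ Inr i $ Inl j = 0" "\<And>i j. A $ Inr i $ Inr j = Q $ i $ j"
  shows "A = block_diag P Q"
  using assms by (auto simp: vec_eq_iff block_diag_def split: sum.split)

lemma block_diag_mult: "block_diag P Q ** block_diag P' Q' = block_diag (P ** P') (Q ** Q')"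
  by (rule block_diag_eqI) (simp_all add: matrix_matrix_mult_def sum_UNIV_Plus)

lemma block_diag_mat_1: "block_diag (mat 1) (mat 1) = mat 1"
  by (rule block_diag_eqI[symmetric]) (auto simp: mat_def)

lemma block_diag_scaleR: "c *\<^sub>R block_diag P Q = block_diag (c *\<^sub>R P) (c *\<^sub>R Q)"
  by (rule block_diag_eqI) simp_all

lemma
  fixes P :: "real^'n::finite^'n" and Q :: "real^'m::finite^'m"
  assumes "invertible P" "invertible Q"
  shows invertible_block_diag: "invertible (block_diag P Q)"
    and matrix_inv_block_diag: "matrix_inv (block_diag P Q) = block_diag (matrix_inv P) (matrix_inv Q)"
proof -
  have 1: "block_diag P Q ** block_diag (matrix_inv P) (matrix_inv Q) = mat 1"
    "block_diag (matrix_inv P) (matrix_inv Q) ** block_diag P Q = mat 1"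
    using assms by (simp_all add: block_diag_mult matrix_inv_right_left block_diag_mat_1)
  then show "invertible (block_diag P Q)" unfolding invertible_def by blast
  show "matrix_inv (block_diag P Q) = block_diag (matrix_inv P) (matrix_inv Q)"
    using 1(1) by (rule matrix_inv_unique)
qed

text \<open>The product of a constant metric \<open>E\<close> with the rescaled metric \<open>c \<gamma>\<close>.  It becomes conformal to
  the warped product when \<open>E\<close> is pseudo-Euclidean and \<open>c = C\<^sup>2\<close> with \<open>f = C/\<phi>\<close>.\<close>

locale product_metric =
  fixes E :: "real^'n::finite^'n" and \<gamma> :: "real^'m::finite \<Rightarrow> real^'m^'m" and R :: "(real^'m) set"
    and c :: real
  assumes E_inv: "invertible E"
    and open_R: "open R"
    and \<gamma>_inv: "y \<in> R \<Longrightarrow> invertible (\<gamma> y)"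
    and \<gamma>_twice: "twice_differentiable R (\<lambda>y. \<gamma> y $ i' $ j')"
    and c_nz: "c \<noteq> 0"
begin

abbreviation "P \<equiv> \<lambda>z :: real^('n + 'm). block_diag E (c *\<^sub>R \<gamma> (vec_snd z))"

lemma \<gamma>_diff: "y \<in> R \<Longrightarrow> (\<lambda>y. \<gamma> y $ i $ j) differentiable at y"
  using \<gamma>_twice unfolding twice_differentiable_def by blast

lemma open_over_R: "open {z. vec_snd z \<in> R}"
  using open_vec_fst_snd[OF open_UNIV open_R] by simp

lemma product_invertible: "vec_snd z \<in> R \<Longrightarrow> invertible (P z)"
  by (intro invertible_block_diag E_inv scalar_invertible c_nz \<gamma>_inv)

lemma matrix_inv_product:
  "vec_snd z \<in> R \<Longrightarrow> matrix_inv (P z) = block_diag (matrix_inv E) ((1 / c) *\<^sub>R matrix_inv (\<gamma> (vec_snd z)))"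
  by (simp add: matrix_inv_block_diag E_inv scalar_invertible c_nz \<gamma>_inv matrix_inv_scaleR)

lemma pd_product:
  assumes "vec_snd z \<in> R"
  shows "pd k (\<lambda>y. P y $ Inl i $ l) z = 0" "pd k (\<lambda>y. P y $ l $ Inl i) z = 0"
    "pd (Inl i) (\<lambda>y. P y $ k $ l) z = 0"
    "pd (Inr s) (\<lambda>y. P y $ Inr i' $ Inr j') z = c * pd s (\<lambda>y. \<gamma> y $ i' $ j') (vec_snd z)"
proof -
  have d: "(\<lambda>z. \<gamma> (vec_snd z) $ i' $ j') differentiable at z" for i' j'
    using \<gamma>_diff[OF assms] by (rule differentiable_vec_snd[of "\<lambda>y. \<gamma> y $ i' $ j'"])
  note pd = pd_vec_snd[OF \<gamma>_diff[OF assms]]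
  show 1: "pd k (\<lambda>y. P y $ Inl i $ l) z = 0" "pd k (\<lambda>y. P y $ l $ Inl i) z = 0" for k i l
    by (cases l; simp)+
  have 2: "pd k (\<lambda>y. P y $ Inr i' $ Inr j') z = c * pd k (\<lambda>y. \<gamma> (vec_snd y) $ i' $ j') z" for k i' j'
    using pd_mult[OF differentiable_const d, of k c] by simp
  show "pd (Inl i) (\<lambda>y. P y $ k $ l) z = 0"
    by (cases k; cases l; simp only: 1 2 pd mult_zero_right)
  show "pd (Inr s) (\<lambda>y. P y $ Inr i' $ Inr j') z = c * pd s (\<lambda>y. \<gamma> y $ i' $ j') (vec_snd z)"
    by (simp only: 2 pd)
qed

lemma christoffel_product:
  assumes "vec_snd z \<in> R"
  shows "christoffel P (Inl i') i j z = 0" "christoffel P l (Inl i') j z = 0"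
    "christoffel P l i (Inl i') z = 0"
    "christoffel P (Inr l') (Inr s') (Inr j') z = christoffel \<gamma> l' s' j' (vec_snd z)"
proof -
  note simps = christoffel_def matrix_inv_product[OF assms] sum_UNIV_Plus pd_product[OF assms]
  show 1: "christoffel P (Inl i') i j z = 0" for i' i j by (simp add: simps)
  show "christoffel P l (Inl i') j z = 0" "christoffel P l i (Inl i') z = 0"
    by (cases l; simp only: 1; simp add: simps)+
  show "christoffel P (Inr l') (Inr s') (Inr j') z = christoffel \<gamma> l' s' j' (vec_snd z)"
    unfolding simps using c_nz by (simp add: right_diff_distrib distrib_left)
qed

lemma pd_christoffel_product:
  assumes "vec_snd z \<in> R"
  shows "pd k (christoffel P (Inl i') i j) z = 0" "pd k (christoffel P l (Inl i') j) z = 0"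
    "pd k (christoffel P l i (Inl i')) z = 0" "pd (Inl i') (christoffel P l i j) z = 0"
    "pd (Inr r) (christoffel P (Inr l') (Inr s') (Inr j')) z = pd r (christoffel \<gamma> l' s' j') (vec_snd z)"
proof -
  have d: "christoffel \<gamma> l' i' j' differentiable at (vec_snd z)" for l' i' j'
    by (rule christoffel_differentiable[OF open_R assms \<gamma>_inv \<gamma>_twice])
  have cong: "pd k (christoffel P l i j) z = pd k u z"
    if "\<And>y. vec_snd y \<in> R \<Longrightarrow> christoffel P l i j y = u y" for k l i j u
    using that assms by (intro pd_cong_open[OF open_over_R]) auto
  have zero: "pd k (christoffel P l i j) z = 0"
    if "\<And>y. vec_snd y \<in> R \<Longrightarrow> christoffel P l i j y = 0" for k l i j
    using cong[OF that] by simp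
  show 1: "pd k (christoffel P (Inl i') i j) z = 0" "pd k (christoffel P l (Inl i') j) z = 0"
    "pd k (christoffel P l i (Inl i')) z = 0" for k l i i' j
    by (rule zero, rule christoffel_product, assumption)+
  have 2: "pd k (christoffel P (Inr l') (Inr s') (Inr j')) z
      = pd k (\<lambda>z. christoffel \<gamma> l' s' j' (vec_snd z)) z" for k l' s' j'
    by (rule cong, rule christoffel_product, assumption)
  show "pd (Inl i') (christoffel P l i j) z = 0"
    by (cases l; cases i; cases j; simp only: 1 2 pd_vec_snd[OF d])
  show "pd (Inr r) (christoffel P (Inr l') (Inr s') (Inr j')) z = pd r (christoffel \<gamma> l' s' j') (vec_snd z)"
    by (simp only: 2 pd_vec_snd[OF d])
qed

text \<open>The constant factor \<open>c\<close> cancels in the Christoffel symbols and hence in the Ricci tensor; it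
  enters only through the inverse metric in the final trace.\<close>

lemma scalar_curvature_product:
  assumes "vec_snd z \<in> R"
  shows "scalar_curvature P z = scalar_curvature \<gamma> (vec_snd z) / c"
proof -
  note simps = ricci_def riemann_def sum_UNIV_Plus christoffel_product[OF assms] pd_christoffel_product[OF assms]
  have 1: "ricci P (Inl i) (Inl j) z = 0" for i j
    by (simp add: simps)
  have 2: "ricci P (Inr i) (Inr j) z = ricci \<gamma> i j (vec_snd z)" for i j
    by (simp add: simps)
  show ?thesis
    by (simp add: scalar_curvature_def[of P] sum_UNIV_Plus matrix_inv_product[OF assms] 1 2)
       (simp add: scalar_curvature_def sum_divide_distrib)
qed

lemma twice_product: "twice_differentiable {z. vec_snd z \<in> R} (\<lambda>z. P z $ k $ l)"
proof -
  show ?thesis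
    unfolding twice_differentiable_def
  proof (intro ballI conjI allI)
    fix z :: "real^('n + 'm)" and r :: "'n + 'm"
    assume "z \<in> {z. vec_snd z \<in> R}"
    then have z: "vec_snd z \<in> R" by simp
    have \<gamma>: "(\<lambda>y. \<gamma> y $ i $ j) differentiable at (vec_snd z)"
      "pd s (\<lambda>y. \<gamma> y $ i $ j) differentiable at (vec_snd z)" for i j s
      using \<gamma>_twice z unfolding twice_differentiable_def by blast+
    have d: "(\<lambda>y. \<gamma> (vec_snd y) $ i $ j) differentiable at z" for i j
      using \<gamma>(1) by (rule differentiable_vec_snd[of "\<lambda>y. \<gamma> y $ i $ j"])
    show "(\<lambda>z. P z $ k $ l) differentiable at z"
      by (cases k; cases l; simp add: d)
    show "pd r (\<lambda>z. P z $ k $ l) differentiable at z"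
    proof (cases "\<exists>s i j. r = Inr s \<and> k = Inr i \<and> l = Inr j")
      case True
      then obtain s i j where rkl: "r = Inr s" "k = Inr i" "l = Inr j" by blast
      have "pd r (\<lambda>z. P z $ k $ l) differentiable at z
         \<longleftrightarrow> (\<lambda>z. c * pd s (\<lambda>y. \<gamma> y $ i $ j) (vec_snd z)) differentiable at z"
        unfolding rkl by (rule differentiable_cong_open[OF open_over_R]) (use z pd_product(4) in auto)
      then show ?thesis using differentiable_vec_snd[OF \<gamma>(2)] by simp
    next
      case False
      have "pd r (\<lambda>z. P z $ k $ l) y = 0" if "vec_snd y \<in> R" for y
        using False by (cases r; cases k; cases l; simp only: pd_product[OF that]; blast)
      then have "pd r (\<lambda>z. P z $ k $ l) differentiable at z \<longleftrightarrow> (\<lambda>z. 0 :: real) differentiable at z"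
        using z by (intro differentiable_cong_open[OF open_over_R]) auto
      then show ?thesis by simp
    qed
  qed
qed

end

section \<open>The warped product metric in coordinates\<close>

lemma twice_differentiable_subset:
  "twice_differentiable V u \<Longrightarrow> W \<subseteq> V \<Longrightarrow> twice_differentiable W u"
  unfolding twice_differentiable_def by blast

lemma sum_if_eq_mult:
  fixes u :: "'k::finite \<Rightarrow> real"
  shows "(\<Sum>s\<in>UNIV. (if i = s then c else 0) * u s) = c * u i"
proof -
  have "(if i = s then c else 0) * u s = c * (kronecker i s * u s)" for s by (simp add: kronecker_def)
  then show ?thesis by (simp only: sum_distrib_left[symmetric] sum_kronecker)
qed

abbreviation warped_gram ::
  "('n::finite \<Rightarrow> real) \<Rightarrow> real^'n \<Rightarrow> (real \<Rightarrow> real) \<Rightarrow> (real \<Rightarrow> real) \<Rightarrow> (real^'m::finite \<Rightarrow> real^'m^'m)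
     \<Rightarrow> real^('n + 'm) \<Rightarrow> real^('n + 'm)^('n + 'm)" where
  "warped_gram \<epsilon> a \<phi> f \<gamma> z \<equiv>
     block_diag (\<chi> i j. if i = j then \<epsilon> i / (\<phi> (lin_form (vec_join a 0) z))\<^sup>2 else 0)
       ((f (lin_form (vec_join a 0) z))\<^sup>2 *\<^sub>R \<gamma> (vec_snd z))"

text \<open>The warped product metric in a chart of the fibre with Gram matrix \<open>\<gamma>\<close> on the coordinate
  domain \<open>R\<close>.  Both \<open>\<phi>\<close> and \<open>f\<close> are arbitrary here: the relation between them is a
  consequence of the soliton equation and is not available when the Hessian is computed.\<close>

locale warped_metric =
  fixes \<epsilon> :: "'n::finite \<Rightarrow> real" and a :: "real^'n"
    and \<gamma> :: "real^'m::finite \<Rightarrow> real^'m^'m" and R :: "(real^'m) set"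
    and J :: "real set" and f f' \<phi> \<phi>' \<phi>'' h h' h'' :: "real \<Rightarrow> real"
  assumes eps: "\<epsilon> i * \<epsilon> i = 1"
    and open_J: "open J" and open_R: "open R"
    and \<gamma>_sym: "y \<in> R \<Longrightarrow> \<gamma> y $ k $ l = \<gamma> y $ l $ k"
    and \<gamma>_inv: "y \<in> R \<Longrightarrow> invertible (\<gamma> y)"
    and \<gamma>_twice: "twice_differentiable R (\<lambda>y. \<gamma> y $ k $ l)"
    and f_nz: "t \<in> J \<Longrightarrow> f t \<noteq> 0" and \<phi>_nz: "t \<in> J \<Longrightarrow> \<phi> t \<noteq> 0"
    and f1: "t \<in> J \<Longrightarrow> (f has_real_derivative f' t) (at t)"
    and \<phi>1: "t \<in> J \<Longrightarrow> (\<phi> has_real_derivative \<phi>' t) (at t)"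
    and \<phi>2: "t \<in> J \<Longrightarrow> (\<phi>' has_real_derivative \<phi>'' t) (at t)"
    and h1: "t \<in> J \<Longrightarrow> (h has_real_derivative h' t) (at t)"
    and h2: "t \<in> J \<Longrightarrow> (h' has_real_derivative h'' t) (at t)"
begin

abbreviation "A \<equiv> vec_join a (0 :: real^'m)"
abbreviation "B \<equiv> vec_join (\<chi> i. \<epsilon> i * a $ i) (0 :: real^'m)"
abbreviation "q \<equiv> \<Sum>k\<in>UNIV. \<epsilon> k * (a $ k)\<^sup>2"
abbreviation "E \<equiv> \<chi> i j. if i = j then \<epsilon> i else 0"
abbreviation "W \<equiv> {z. vec_fst z \<in> strip a J \<and> vec_snd z \<in> R}"
abbreviation "Gw \<equiv> \<lambda>z. warped_gram \<epsilon> a \<phi> f \<gamma> z"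
abbreviation "\<omega> \<equiv> \<lambda>t. \<phi>' t / \<phi> t"

lemma open_W: "open W"
  by (intro open_vec_fst_snd open_strip open_J open_R)

lemma W_iff: "z \<in> W \<longleftrightarrow> lin_form A z \<in> J \<and> vec_snd z \<in> R"
  by (simp add: strip_def lin_form_vec_fst)

lemma eps_nz: "\<epsilon> i \<noteq> 0"
  using eps[of i] by auto

lemma diag_invertible:
  assumes "\<And>i. u i \<noteq> 0"
  shows "invertible ((\<chi> i j. if i = j then u i else 0) :: real^'n^'n)"
proof -
  have "(\<chi> i j. if i = j then u i else 0) ** ((\<chi> i j. if i = j then 1 / u i else 0) :: real^'n^'n) = mat 1"
    using assms by (simp add: matrix_matrix_mult_def mat_def vec_eq_iff sum_if_eq_mult)
  then show ?thesis using matrix_left_right_inverse unfolding invertible_def by blast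
qed

lemma warped_gram_invertible: "z \<in> W \<Longrightarrow> invertible (Gw z)"
  unfolding W_iff
  by (intro invertible_block_diag diag_invertible scalar_invertible \<gamma>_inv) (auto simp: eps_nz \<phi>_nz f_nz)

lemma warped_gram_symmetric: "z \<in> W \<Longrightarrow> Gw z $ k $ l = Gw z $ l $ k"
  unfolding W_iff by (cases k; cases l) (auto simp: \<gamma>_sym)

lemma AB: "(\<Sum>i\<in>UNIV. A $ i * B $ i) = q"
  by (simp add: sum_UNIV_Plus power2_eq_square mult_ac)

lemma inverse_square_derivative:
  assumes "t \<in> J"
  shows "((\<lambda>t. 1 / (\<phi> t)\<^sup>2) has_real_derivative - 2 * \<omega> t * (1 / (\<phi> t)\<^sup>2)) (at t)"
  by (rule derivative_eq_intros \<phi>1 assms refl | use \<phi>_nz assms in force)+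
     (use \<phi>_nz[OF assms] in \<open>simp add: field_simps power2_eq_square power3_eq_cube\<close>)

lemma pd_warped_gram:
  assumes "z \<in> W"
  defines "t \<equiv> lin_form A z"
  shows "pd k (\<lambda>y. Gw y $ Inl i $ Inl j) z = (if i = j then \<epsilon> i else 0) * (- 2 * \<omega> t / (\<phi> t)\<^sup>2) * A $ k"
    and "pd k (\<lambda>y. Gw y $ Inl i $ Inr j') z = 0" "pd k (\<lambda>y. Gw y $ Inr j' $ Inl i) z = 0"
    and "pd (Inl i) (\<lambda>y. Gw y $ Inr k' $ Inr l') z = 2 * f t * f' t * a $ i * \<gamma> (vec_snd z) $ k' $ l'"
proof -
  have t: "lin_form A z \<in> J" and zR: "vec_snd z \<in> R" using assms unfolding W_iff by auto
  note d = inverse_square_derivative[OF t]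
  have "pd k (\<lambda>y. (if i = j then \<epsilon> i else 0) * (1 / (\<phi> (lin_form A y))\<^sup>2)) z
      = (if i = j then \<epsilon> i else 0) * (- 2 * \<omega> t * (1 / (\<phi> t)\<^sup>2) * A $ k)"
    by (subst pd_mult[OF differentiable_const differentiable_lin_form[OF d]])
       (simp only: pd_lin_form[OF d] pd_const t_def mult_zero_left add_0_left)
  moreover have "(\<lambda>y. Gw y $ Inl i $ Inl j) = (\<lambda>y. (if i = j then \<epsilon> i else 0) * (1 / (\<phi> (lin_form A y))\<^sup>2))"
    by auto
  ultimately show "pd k (\<lambda>y. Gw y $ Inl i $ Inl j) z = (if i = j then \<epsilon> i else 0) * (- 2 * \<omega> t / (\<phi> t)\<^sup>2) * A $ k"
    by (simp only:) simp
  show "pd k (\<lambda>y. Gw y $ Inl i $ Inr j') z = 0" "pd k (\<lambda>y. Gw y $ Inr j' $ Inl i) z = 0"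
    by simp_all
  have df: "((\<lambda>t. (f t)\<^sup>2) has_real_derivative 2 * f t * f' t) (at t)"
    unfolding t_def by (rule derivative_eq_intros f1 t refl)+ simp
  have d\<gamma>: "(\<lambda>y. \<gamma> y $ k' $ l') differentiable at (vec_snd z)"
    using \<gamma>_twice zR unfolding twice_differentiable_def by blast
  have "pd (Inl i) (\<lambda>y. (f (lin_form A y))\<^sup>2 * \<gamma> (vec_snd y) $ k' $ l') z
      = 2 * f t * f' t * a $ i * \<gamma> (vec_snd z) $ k' $ l'"
    by (subst pd_mult[OF differentiable_lin_form[OF df[unfolded t_def]] differentiable_vec_snd[OF d\<gamma>]])
       (simp add: pd_lin_form[OF df[unfolded t_def]] pd_vec_snd[OF d\<gamma>] t_def)
  then show "pd (Inl i) (\<lambda>y. Gw y $ Inr k' $ Inr l') z = 2 * f t * f' t * a $ i * \<gamma> (vec_snd z) $ k' $ l'"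
    by simp
qed

text \<open>The vector dual to \<open>d\<xi>\<close> is \<open>\<phi>\<^sup>2 B\<close>, which is tangent to the base.  By
  \<open>christoffel_contract\<close> only derivatives of the metric along \<open>\<xi>\<close> therefore enter: on the base
  block those of \<open>\<phi>\<^sup>-\<^sup>2\<close>, on the fibre block those of \<open>f\<^sup>2\<close>.\<close>

lemma hessian_warped_gram:
  assumes z: "z \<in> W"
  defines "t \<equiv> lin_form A z" and "H \<equiv> hessian Gw (\<lambda>z. h (lin_form A z)) z"
  shows "H $ Inl i $ Inl j = (h'' t + 2 * \<omega> t * h' t) * a $ i * a $ j
            - \<omega> t * h' t * q * (if i = j then \<epsilon> i else 0)"
    and "H $ Inl i $ Inr j' = 0" "H $ Inr j' $ Inl i = 0"
    and "H $ Inr k' $ Inr l' = (\<phi> t)\<^sup>2 * q * f t * f' t * h' t * \<gamma> (vec_snd z) $ k' $ l'"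
proof -
  have t: "t \<in> J" and zR: "vec_snd z \<in> R" using z unfolding W_iff t_def by auto
  have p: "\<phi> t \<noteq> 0" using \<phi>_nz[OF t] .
  \<comment> \<open>The gradient of \<open>\<xi>\<close> with respect to the warped metric.\<close>
  define v where "v = (\<phi> t)\<^sup>2 *\<^sub>R B"
  have Gv: "(\<Sum>l\<in>UNIV. Gw z $ k $ l * v $ l) = A $ k" for k
  proof (cases k)
    case (Inl i)
    have "\<epsilon> i * (\<epsilon> i * x) = x" for x using eps[of i] by (simp flip: mult.assoc)
    then show ?thesis using p
      by (simp add: Inl v_def sum_UNIV_Plus t_def sum_if_eq_mult)
  qed (simp add: v_def sum_UNIV_Plus)
  let ?X = "\<lambda>i j. \<Sum>s\<in>UNIV. v $ s * (pd i (\<lambda>y. Gw y $ j $ s) z + pd j (\<lambda>y. Gw y $ i $ s) z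
      - pd s (\<lambda>y. Gw y $ i $ j) z)"
  have "pd i (pd j (\<lambda>z. h (lin_form A z))) z = h'' t * A $ i * A $ j" for i j
  proof -
    have "pd i (pd j (\<lambda>z. h (lin_form A z))) z = pd i (\<lambda>y. h' (lin_form A y) * A $ j) z"
      by (rule pd_cong_open[OF open_W z]) (simp add: pd_lin_form[OF h1] W_iff del: mem_Collect_eq)
    also have "\<dots> = h'' t * A $ i * A $ j"
      unfolding t_def using h2 t
      by (subst pd_mult[OF differentiable_lin_form differentiable_const])
         (auto simp: t_def pd_lin_form[OF h2])
    finally show ?thesis .
  qed
  moreover have "(\<Sum>l\<in>UNIV. christoffel Gw l i j z * pd l (\<lambda>z. h (lin_form A z)) z) = h' t * (?X i j / 2)" for i j
  proof -
    have "(\<Sum>l\<in>UNIV. christoffel Gw l i j z * pd l (\<lambda>z. h (lin_form A z)) z)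
        = h' t * (\<Sum>l\<in>UNIV. christoffel Gw l i j z * A $ l)"
      by (simp add: pd_lin_form[OF h1[OF t[unfolded t_def]]] t_def[symmetric] sum_distrib_left mult.left_commute)
    then show ?thesis
      by (simp only: christoffel_contract[where G = Gw, OF warped_gram_invertible[OF z] warped_gram_symmetric[OF z] Gv])
  qed
  ultimately have H: "H $ i $ j = h'' t * A $ i * A $ j - h' t * (?X i j / 2)" for i j
    unfolding H_def hessian_def by simp
  have pq: "(\<Sum>i\<in>UNIV. \<epsilon> i * a $ i * a $ i) = q" by (simp add: power2_eq_square mult.assoc)
  note pd = pd_warped_gram[OF z, folded t_def]
  have X: "?X i j = (\<Sum>s\<in>UNIV. (\<phi> t)\<^sup>2 * (\<epsilon> s * a $ s) * (pd i (\<lambda>y. Gw y $ j $ Inl s) z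
      + pd j (\<lambda>y. Gw y $ i $ Inl s) z - pd (Inl s) (\<lambda>y. Gw y $ i $ j) z))" for i j
    by (simp add: sum_UNIV_Plus v_def)
  have X1: "?X (Inl i) (Inl j) = - 4 * \<omega> t * a $ i * a $ j + 2 * \<omega> t * q * (if i = j then \<epsilon> i else 0)"
  proof -
    have "?X (Inl i) (Inl j) = (\<Sum>s\<in>UNIV. - 2 * \<omega> t * (
          kronecker j s * (\<epsilon> s * \<epsilon> s * a $ s * a $ i) + kronecker i s * (\<epsilon> s * \<epsilon> s * a $ s * a $ j)
          - (if i = j then \<epsilon> i else 0) * (\<epsilon> s * a $ s * a $ s)))"
      unfolding X unfolding pd
    proof (intro sum.cong refl)
      fix s
      have "(if j = s then \<epsilon> j else 0) = kronecker j s * \<epsilon> s" "(if i = s then \<epsilon> i else 0) = kronecker i s * \<epsilon> s"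
        by (auto simp: kronecker_def)
      then show "(\<phi> t)\<^sup>2 * (\<epsilon> s * a $ s) * ((if j = s then \<epsilon> j else 0) * (- 2 * \<omega> t / (\<phi> t)\<^sup>2) * A $ Inl i
          + (if i = s then \<epsilon> i else 0) * (- 2 * \<omega> t / (\<phi> t)\<^sup>2) * A $ Inl j
          - (if i = j then \<epsilon> i else 0) * (- 2 * \<omega> t / (\<phi> t)\<^sup>2) * A $ Inl s)
        = - 2 * \<omega> t * (
          kronecker j s * (\<epsilon> s * \<epsilon> s * a $ s * a $ i) + kronecker i s * (\<epsilon> s * \<epsilon> s * a $ s * a $ j)
          - (if i = j then \<epsilon> i else 0) * (\<epsilon> s * a $ s * a $ s))"
        using p by (simp only: vec_join_nth) (simp add: field_simps)
    qed
    also have "\<dots> = - 2 * \<omega> t * (\<epsilon> j * \<epsilon> j * a $ j * a $ i + \<epsilon> i * \<epsilon> i * a $ i * a $ j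
          - (if i = j then \<epsilon> i else 0) * q)"
      by (simp only: sum_distrib_left[symmetric] sum.distrib sum_subtractf sum_kronecker pq)
    finally show ?thesis by (simp only: eps) (simp add: algebra_simps)
  qed
  have X2: "?X (Inl i) (Inr j') = 0" "?X (Inr j') (Inl i) = 0"
    unfolding X unfolding pd by (simp_all del: block_diag_nth)
  have X3: "?X (Inr k') (Inr l') = - 2 * (\<phi> t)\<^sup>2 * q * f t * f' t * \<gamma> (vec_snd z) $ k' $ l'"
  proof -
    have "?X (Inr k') (Inr l') = (\<Sum>s\<in>UNIV. (- 2 * (\<phi> t)\<^sup>2 * f t * f' t * \<gamma> (vec_snd z) $ k' $ l') * (\<epsilon> s * a $ s * a $ s))"
      unfolding X unfolding pd by (intro sum.cong refl) simp
    then show ?thesis by (simp only: sum_distrib_left[symmetric] pq) simp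
  qed
  show "H $ Inl i $ Inl j = (h'' t + 2 * \<omega> t * h' t) * a $ i * a $ j
            - \<omega> t * h' t * q * (if i = j then \<epsilon> i else 0)"
  proof -
    have "h2 * x * y - h1 * ((- 4 * w * x * y + 2 * w * q * e) / 2) = (h2 + 2 * w * h1) * x * y - w * h1 * q * e"
      for h1 h2 w x y e q :: real by (simp add: field_simps)
    then show ?thesis unfolding H X1 vec_join_nth .
  qed
  show "H $ Inl i $ Inr j' = 0" "H $ Inr j' $ Inl i = 0"
    unfolding H X2 by simp_all
  show "H $ Inr k' $ Inr l' = (\<phi> t)\<^sup>2 * q * f t * f' t * h' t * \<gamma> (vec_snd z) $ k' $ l'"
    unfolding H X3 by simp
qed

text \<open>On the base block the soliton equation reads \<open>X a\<^sub>i a\<^sub>j = Y \<epsilon>\<^sub>i \<delta>\<^sub>i\<^sub>j\<close> with scalars \<open>X\<close>, \<open>Y\<close>.  A matrix of rank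
  at most one cannot be a nonzero multiple of a nondegenerate diagonal matrix of size at
  least two, so both sides vanish.  The fibre block gives one scalar equation since \<open>\<gamma>\<close> is nonzero.\<close>

lemma soliton_at_point:
  assumes z: "z \<in> W" and two: "CARD('n) \<ge> 2" and q_nz: "q \<noteq> 0"
  defines "t \<equiv> lin_form A z"
  shows "S *\<^sub>R Gw z = hessian Gw (\<lambda>z. h (lin_form A z)) z \<longleftrightarrow>
      h'' t * \<phi> t + 2 * \<phi>' t * h' t = 0 \<and> S = - q * \<phi> t * \<phi>' t * h' t \<and> S * f t = q * (\<phi> t)\<^sup>2 * f' t * h' t"
    (is "?L \<longleftrightarrow> ?X = 0 \<and> ?S \<and> ?F")
proof -
  let ?H = "hessian Gw (\<lambda>z. h (lin_form A z)) z"
  have t: "t \<in> J" and zR: "vec_snd z \<in> R" using z unfolding W_iff t_def by auto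
  have p: "\<phi> t \<noteq> 0" and ft: "f t \<noteq> 0" using \<phi>_nz[OF t] f_nz[OF t] by auto
  note hess = hessian_warped_gram[OF z, folded t_def]
  have X: "h'' t + 2 * \<omega> t * h' t = ?X / \<phi> t" using p by (simp add: field_simps)
  have base: "S * (if i = j then \<epsilon> i / (\<phi> t)\<^sup>2 else 0) = ?H $ Inl i $ Inl j
     \<longleftrightarrow> ?X * \<phi> t * a $ i * a $ j = (if i = j then \<epsilon> i else 0) * (S + q * \<phi> t * \<phi>' t * h' t)" for i j
    unfolding hess X using p by (auto simp: field_simps power2_eq_square)
  have fibre: "S * (f t)\<^sup>2 * \<gamma> (vec_snd z) $ k $ l = ?H $ Inr k $ Inr l
     \<longleftrightarrow> \<gamma> (vec_snd z) $ k $ l = 0 \<or> ?F" for k l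
    unfolding hess using ft by (auto simp: power2_eq_square)
  have "?L \<longleftrightarrow> (\<forall>k l. (S *\<^sub>R Gw z) $ k $ l = ?H $ k $ l)" by (simp only: vec_eq_iff)
  also have "\<dots> \<longleftrightarrow> (\<forall>i j. S * (if i = j then \<epsilon> i / (\<phi> t)\<^sup>2 else 0) = ?H $ Inl i $ Inl j) \<and>
      (\<forall>k l. S * (f t)\<^sup>2 * \<gamma> (vec_snd z) $ k $ l = ?H $ Inr k $ Inr l)"
    by (simp add: split_sum_all hess t_def[symmetric] mult.assoc)
  also have "(\<forall>i j. S * (if i = j then \<epsilon> i / (\<phi> t)\<^sup>2 else 0) = ?H $ Inl i $ Inl j) \<longleftrightarrow> ?X = 0 \<and> ?S"
    unfolding base
  proof
    assume *: "\<forall>i j. ?X * \<phi> t * a $ i * a $ j = (if i = j then \<epsilon> i else 0) * (S + q * \<phi> t * \<phi>' t * h' t)"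
    obtain i where i: "a $ i \<noteq> 0" using q_nz by (metis (no_types, lifting) mult_zero_right power_zero_numeral sum.neutral)
    \<comment> \<open>An off-diagonal entry excludes \<open>X \<noteq> 0\<close> if \<open>a\<^sub>j \<noteq> 0\<close>; otherwise the diagonal entries at \<open>i\<close> and \<open>j\<close> are compared.\<close>
    obtain j where j: "j \<noteq> i"
    proof -
      have "UNIV \<noteq> {i}"
      proof
        assume "UNIV = {i}"
        then have "CARD('n) = card {i}" by (rule arg_cong)
        then show False using two by simp
      qed
      then show thesis using that by blast
    qed
    have "?X * \<phi> t * a $ i * a $ j = 0" using *[rule_format, of i j] j by simp
    moreover have "?X = 0" if "a $ j = 0"
    proof -
      have "S + q * \<phi> t * \<phi>' t * h' t = 0" using *[rule_format, of j j] that eps_nz by simp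
      then have "?X * \<phi> t * a $ i * a $ i = 0" using *[rule_format, of i i] by simp
      then show ?thesis using p i by simp
    qed
    ultimately have X0: "?X = 0" using p i by auto
    then have "\<epsilon> i * (S + q * \<phi> t * \<phi>' t * h' t) = 0" using *[rule_format, of i i] by simp
    then show "?X = 0 \<and> ?S" using X0 eps_nz by simp
  qed simp
  also have "(\<forall>k l. S * (f t)\<^sup>2 * \<gamma> (vec_snd z) $ k $ l = ?H $ Inr k $ Inr l) \<longleftrightarrow> ?F"
  proof -
    have "\<not> (\<forall>k l. \<gamma> (vec_snd z) $ k $ l = 0)"
    proof
      assume "\<forall>k l. \<gamma> (vec_snd z) $ k $ l = 0"
      then have "\<gamma> (vec_snd z) = 0" by (simp add: vec_eq_iff)
      then have "(mat 1 :: real^'m^'m) = 0"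
        using \<gamma>_inv[OF zR] unfolding invertible_def by (auto simp: matrix_matrix_mult_def vec_eq_iff)
      then have "(mat 1 :: real^'m^'m) $ undefined $ undefined = 0" by simp
      then show False by (simp add: mat_def)
    qed
    then show ?thesis unfolding fibre by blast
  qed
  finally show ?thesis by blast
qed

text \<open>For \<open>f = C/\<phi>\<close> the warped product is conformal to a product metric, and the fibre coordinates
  enter the scalar curvature only through the vanishing scalar curvature of \<open>\<gamma>\<close>.\<close>

lemma scalar_curvature_warped_gram:
  assumes z: "z \<in> W" and f: "\<And>t. t \<in> J \<Longrightarrow> f t = C / \<phi> t" and C: "C \<noteq> 0"
    and flat: "scalar_curvature \<gamma> (vec_snd z) = 0"
  defines "t \<equiv> lin_form A z" and "N \<equiv> real CARD('n) + real CARD('m)"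
  shows "scalar_curvature Gw z = (N - 1) * (2 * \<phi> t * \<phi>'' t - N * (\<phi>' t)\<^sup>2) * q"
proof -
  interpret P: product_metric E \<gamma> R "C\<^sup>2"
  proof
    show "invertible E" by (rule diag_invertible) (rule eps_nz)
  qed (use C in \<open>simp_all add: open_R \<gamma>_inv \<gamma>_twice\<close>)
  have sub: "vec_snd y \<in> R" if "y \<in> W" for y using that by simp
  interpret C: conformal_change P.P W A B J \<phi> \<phi>' \<phi>''
  proof
    show "open W" by (rule open_W)
    show "P.P z $ i $ j = P.P z $ j $ i" if "z \<in> W" for z i j
      using \<gamma>_sym[OF sub[OF that]] by (cases i; cases j) auto
    show "invertible (P.P z)" if "z \<in> W" for z by (rule P.product_invertible[OF sub[OF that]])
    show "twice_differentiable W (\<lambda>z. P.P z $ i $ j)" for i j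
      by (rule twice_differentiable_subset[OF P.twice_product]) auto
    have ee: "\<epsilon> i * (\<epsilon> i * x) = x" for i x using eps[of i] by (simp flip: mult.assoc)
    show "(\<Sum>j\<in>UNIV. P.P z $ i $ j * B $ j) = A $ i" for z i
      by (cases i) (simp_all add: sum_UNIV_Plus sum_if_eq_mult ee)
    show "(\<Sum>s\<in>UNIV. B $ s * pd s (\<lambda>y. P.P y $ i $ j) z) = 0" if "z \<in> W" for z i j
      unfolding sum_UNIV_Plus P.pd_product(3)[OF sub[OF that]] by simp
  qed (use W_iff \<phi>_nz \<phi>1 \<phi>2 in auto)
  have N: "real CARD('n + 'm) = N" by (simp add: N_def)
  have "scalar_curvature Gw z = scalar_curvature (\<lambda>z. (1 / (\<phi> (lin_form A z))\<^sup>2) *\<^sub>R P.P z) z"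
  proof (rule scalar_curvature_cong_open[OF open_W z])
    fix y assume "y \<in> W"
    then have "f (lin_form A y) = C / \<phi> (lin_form A y)" using f unfolding W_iff by blast
    then show "Gw y = (1 / (\<phi> (lin_form A y))\<^sup>2) *\<^sub>R P.P y"
      by (simp add: block_diag_scaleR power_divide vec_eq_iff block_diag_def split: sum.split)
  qed
  also have "\<dots> = (N - 1) * (2 * \<phi> t * \<phi>'' t - N * (\<phi>' t)\<^sup>2) * q"
    using C.scalar_curvature_conformal[OF z] P.scalar_curvature_product[OF sub[OF z]] flat
    unfolding N AB t_def by simp
  finally show ?thesis .
qed

end

text \<open>The chart of the base is the identity, so the charts of the warped product are parametrised by those of
  the fibre.  On the open coordinate domain the inverse chart recovers the base point, and
  curvature and Hessian depend on germs only.\<close>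

lemma soliton_in_coordinates:
  fixes F :: "('q, 'm::finite) mmanifold" and a :: "real^'n::finite"
  assumes J: "open J" and R: "\<And>d. d \<in> charts F \<Longrightarrow> open (crange d)"
  shows "steady_gradient_yamabe_soliton
           (warped_product (conformal_pseudo_euclidean (strip a J) \<epsilon> (\<lambda>x. \<phi> (lin_form a x)))
              (\<lambda>x. f (lin_form a x)) F) (\<lambda>(x, q). h (lin_form a x))
     \<longleftrightarrow> (\<forall>d\<in>charts F. \<forall>z. vec_fst z \<in> strip a J \<and> vec_snd z \<in> crange d \<longrightarrow>
           scalar_curvature (warped_gram \<epsilon> a \<phi> f (gram d)) z *\<^sub>R warped_gram \<epsilon> a \<phi> f (gram d) z
           = hessian (warped_gram \<epsilon> a \<phi> f (gram d)) (\<lambda>z. h (lin_form (vec_join a 0) z)) z)"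
proof -
  define base where "base = \<lparr> cdom = strip a J, coord = (\<lambda>x :: real^'n. x),
      gram = (\<lambda>x. \<chi> i j. if i = j then \<epsilon> i / (\<phi> (lin_form a x))\<^sup>2 else 0) \<rparr>"
  define wc :: "('q, 'm) mchart \<Rightarrow> ((real^'n) \<times> 'q, 'n + 'm) mchart"
    where "wc = warped_chart (\<lambda>x. f (lin_form a x)) base"
  have charts: "charts (warped_product (conformal_pseudo_euclidean (strip a J) \<epsilon> (\<lambda>x. \<phi> (lin_form a x)))
        (\<lambda>x. f (lin_form a x)) F) = wc ` charts F"
    unfolding warped_product_def conformal_pseudo_euclidean_def wc_def base_def by auto
  have crange: "crange (wc d) = {z. vec_fst z \<in> strip a J \<and> vec_snd z \<in> crange d}" for d
  proof -
    have "z \<in> crange (wc d)" if z: "vec_fst z \<in> strip a J" "vec_snd z \<in> crange d" for z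
    proof -
      obtain q where "q \<in> cdom d" "vec_snd z = coord d q" using z(2) unfolding crange_def by blast
      then have "z = coord (wc d) (vec_fst z, q)" "(vec_fst z, q) \<in> cdom (wc d)"
        using z(1) vec_join_fst_snd[of z] by (simp_all add: wc_def base_def warped_chart_def)
      then show ?thesis unfolding crange_def by blast
    qed
    moreover have "vec_fst z \<in> strip a J \<and> vec_snd z \<in> crange d" if "z \<in> crange (wc d)" for z
      using that unfolding crange_def wc_def base_def warped_chart_def by auto
    ultimately show ?thesis by blast
  qed
  have inv: "fst (cinv (wc d) z) = vec_fst z" if "z \<in> crange (wc d)" for d z
  proof -
    have "coord (wc d) (cinv (wc d) z) = z"
      using that unfolding crange_def cinv_def by (rule f_inv_into_f)
    then show ?thesis
      by (metis (no_types, lifting) base_def case_prod_beta mchart.select_convs(2) vec_fst_join warped_chart_def wc_def)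
  qed
  have gram: "gram (wc d) z = warped_gram \<epsilon> a \<phi> f (gram d) z" if "z \<in> crange (wc d)" for d z
  proof -
    have "vec_fst z \<in> strip a J" using that unfolding crange by simp
    then have "cinv base (vec_fst z) = vec_fst z"
      using inv_into_f_f[of "\<lambda>x. x" "strip a J" "vec_fst z"] by (simp add: cinv_def base_def)
    then have "gram (wc d) z = block_diag (gram base (vec_fst z)) ((f (lin_form a (vec_fst z)))\<^sup>2 *\<^sub>R gram d (vec_snd z))"
      by (simp add: wc_def warped_chart_def)
    then show ?thesis unfolding base_def mchart.simps lin_form_vec_fst .
  qed
  have "scalar_curvature (gram (wc d)) z *\<^sub>R gram (wc d) z = hessian (gram (wc d)) ((\<lambda>(x, q). h (lin_form a x)) \<circ> cinv (wc d)) z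
     \<longleftrightarrow> scalar_curvature (warped_gram \<epsilon> a \<phi> f (gram d)) z *\<^sub>R warped_gram \<epsilon> a \<phi> f (gram d) z
           = hessian (warped_gram \<epsilon> a \<phi> f (gram d)) (\<lambda>z. h (lin_form (vec_join a 0) z)) z"
    if "d \<in> charts F" "z \<in> crange (wc d)" for d z
  proof -
    have op: "open (crange (wc d))"
      unfolding crange by (intro open_vec_fst_snd open_strip J R that(1))
    have "scalar_curvature (gram (wc d)) z = scalar_curvature (warped_gram \<epsilon> a \<phi> f (gram d)) z"
      by (rule scalar_curvature_cong_open[OF op that(2) gram])
    moreover have "hessian (gram (wc d)) ((\<lambda>(x, q). h (lin_form a x)) \<circ> cinv (wc d)) z
        = hessian (warped_gram \<epsilon> a \<phi> f (gram d)) (\<lambda>z. h (lin_form (vec_join a 0) z)) z"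
      by (rule hessian_cong_open[OF op that(2) gram])
         (simp_all add: case_prod_beta inv lin_form_vec_fst)
    ultimately show ?thesis by (simp only: gram[OF that(2)])
  qed
  then have "(\<forall>d\<in>charts F. \<forall>z\<in>crange (wc d). scalar_curvature (gram (wc d)) z *\<^sub>R gram (wc d) z
        = hessian (gram (wc d)) ((\<lambda>(x, q). h (lin_form a x)) \<circ> cinv (wc d)) z)
     \<longleftrightarrow> (\<forall>d\<in>charts F. \<forall>z\<in>crange (wc d). scalar_curvature (warped_gram \<epsilon> a \<phi> f (gram d)) z *\<^sub>R warped_gram \<epsilon> a \<phi> f (gram d) z
           = hessian (warped_gram \<epsilon> a \<phi> f (gram d)) (\<lambda>z. h (lin_form (vec_join a 0) z)) z)"
    by (intro ball_cong refl) blast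
  then show ?thesis
    unfolding steady_gradient_yamabe_soliton_def gradient_yamabe_soliton_def charts diff_0_right ball_simps
    by (simp only: crange mem_Collect_eq Ball_def)
qed

section \<open>The ordinary differential equation for the conformal factor\<close>

lemma constant_sign:
  fixes u :: "real \<Rightarrow> real"
  assumes "is_interval J" "continuous_on J u" "\<And>t. t \<in> J \<Longrightarrow> u t \<noteq> 0"
  shows "(\<forall>t\<in>J. u t > 0) \<or> (\<forall>t\<in>J. u t < 0)"
proof (rule ccontr)
  assume "\<not> ?thesis"
  then obtain s t where st: "s \<in> J" "t \<in> J" "u s \<le> 0" "u t \<ge> 0" by force
  have "connected (u ` J)"
    using assms(1,2) by (simp add: connected_continuous_image is_interval_connected)
  then have "0 \<in> u ` J" using st connected_iff_interval by blast
  then show False using assms(3) by auto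
qed

lemma constant_of_zero_derivative:
  fixes u :: "real \<Rightarrow> real"
  assumes "is_interval J" "\<And>t. t \<in> J \<Longrightarrow> (u has_real_derivative 0) (at t)"
  shows "\<exists>c. \<forall>t\<in>J. u t = c"
  using has_field_derivative_zero_constant[of J u] assms
  by (auto simp: is_interval_convex intro: has_field_derivative_at_within)

text \<open>Uniqueness for a homogeneous linear equation: multiplied by the integrating factor, \<open>u\<close> becomes constant.\<close>

lemma linear_ode_zero:
  fixes u p :: "real \<Rightarrow> real"
  assumes J: "is_interval J" and p: "continuous_on J p"
    and u: "\<And>t. t \<in> J \<Longrightarrow> (u has_real_derivative p t * u t) (at t)"
    and t0: "t0 \<in> J" "u t0 = 0" and t: "t \<in> J"
  shows "u t = 0"
proof -
  define I where "I = {min t0 t..max t0 t}"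
  have IJ: "I \<subseteq> J"
  proof
    fix s assume "s \<in> I"
    then show "s \<in> J"
      using mem_is_interval_1_I[OF J t0(1) t, of s] mem_is_interval_1_I[OF J t t0(1), of s]
      by (cases "t0 \<le> t") (auto simp: I_def)
  qed
  obtain P where P: "\<And>s. s \<in> I \<Longrightarrow> (P has_real_derivative p s) (at s within I)"
    using antiderivative_continuous[of "min t0 t" "max t0 t" p] continuous_on_subset[OF p IJ]
    unfolding I_def has_real_derivative_iff_has_vector_derivative by blast
  have "((\<lambda>s. exp (- P s) * u s) has_real_derivative 0) (at s within I)" if "s \<in> I" for s
  proof -
    have u': "(u has_real_derivative p s * u s) (at s within I)"
      by (rule has_field_derivative_at_within) (use u IJ that in auto)
    show ?thesis
      by (rule derivative_eq_intros P[OF that] u' refl)+ (simp add: algebra_simps)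
  qed
  then have "\<exists>c. \<forall>s\<in>I. exp (- P s) * u s = c"
    by (intro has_field_derivative_zero_constant) (simp_all add: I_def)
  then obtain c where "\<And>s. s \<in> I \<Longrightarrow> exp (- P s) * u s = c" by blast
  from this[of t0] this[of t] show ?thesis using t0(2) by (auto simp: I_def)
qed

lemma has_real_derivative_powr_compose:
  assumes "(u has_real_derivative u') (at t)" "u t > 0"
  shows "((\<lambda>t. u t powr r) has_real_derivative r * u t powr r * u' / u t) (at t)"
proof -
  have "((\<lambda>t. u t powr r) has_real_derivative r * u t powr (r - 1) * u') (at t)"
    by (rule DERIV_chain2[OF has_real_derivative_powr[OF assms(2)] assms(1)])
  then show ?thesis using assms(2) by (simp add: powr_diff)
qed

lemma no_positive_function_on_left_ray:
  fixes v v' :: "real \<Rightarrow> real"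
  assumes "\<And>t. t \<le> 0 \<Longrightarrow> (v has_real_derivative v' t) (at t)"
    and "\<And>t. t \<le> 0 \<Longrightarrow> v t > 0" and "\<And>t. t \<le> 0 \<Longrightarrow> v' t \<ge> \<delta>" and "\<delta> > 0"
  shows False
proof -
  define T where "T = - (v 0 / \<delta>)"
  have T: "T \<le> 0" unfolding T_def using assms(2)[of 0] assms(4) by simp
  have "v T - \<delta> * T \<le> v 0 - \<delta> * 0"
  proof (rule DERIV_nonneg_imp_nondecreasing[OF T])
    fix t assume "T \<le> t" "t \<le> 0"
    then show "\<exists>y. ((\<lambda>t. v t - \<delta> * t) has_real_derivative y) (at t) \<and> 0 \<le> y"
      using assms(1,3) by (intro exI[of _ "v' t - \<delta>"]) (auto intro!: derivative_eq_intros)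
  qed
  moreover have "\<delta> * T = - v 0" unfolding T_def using assms(4) by simp
  ultimately show False using assms(2)[OF T] by simp
qed

text \<open>What the soliton equation says about the conformal factor once \<open>h' = \<alpha>/\<phi>\<^sup>2\<close> and
  \<open>f = C/\<phi>\<close> have been substituted.\<close>

definition yamabe_ode :: "real \<Rightarrow> real \<Rightarrow> real set \<Rightarrow> (real \<Rightarrow> real) \<Rightarrow> (real \<Rightarrow> real) \<Rightarrow> (real \<Rightarrow> real) \<Rightarrow> bool"
  where "yamabe_ode N \<alpha> J \<phi> \<phi>' \<phi>'' \<longleftrightarrow>
    (\<forall>t\<in>J. (\<phi> has_real_derivative \<phi>' t) (at t) \<and> (\<phi>' has_real_derivative \<phi>'' t) (at t) \<and>
       (N - 1) * (2 * \<phi> t * \<phi>'' t - N * (\<phi>' t)\<^sup>2) = - \<alpha> * \<phi>' t / \<phi> t)"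

text \<open>Seen as an equation for \<open>p = \<phi>'\<close> as a function of \<open>\<phi>\<close>, the equation is
  \<open>2\<phi> dp/d\<phi> - N p = const/\<phi>\<close>.  It has the particular solution \<open>A/\<phi>\<close>, and the homogeneous equation
  the solutions \<open>K\<phi>\<^bsup>N/2\<^esup>\<close>.  The proof verifies that \<open>K\<close>, expressed by
  \<open>\<phi>\<close> and \<open>\<phi>'\<close>, has derivative zero, which avoids any division by \<open>\<phi>'\<close>.\<close>

lemma yamabe_ode_first_integral:
  assumes ode: "yamabe_ode N \<alpha> J \<phi> \<phi>' \<phi>''" and J: "is_interval J" and N: "N > 2"
    and pos: "\<And>t. t \<in> J \<Longrightarrow> \<phi> t > 0"
  shows "\<exists>K. \<forall>t\<in>J. \<phi> t * \<phi>' t = \<alpha> / ((N - 1) * (N + 2)) + K * \<phi> t powr (N / 2 + 1)"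
proof -
  define A where "A = \<alpha> / ((N - 1) * (N + 2))"
  have "((\<lambda>t. (\<phi> t * \<phi>' t - A) * \<phi> t powr (- (N / 2 + 1))) has_real_derivative 0) (at t)" if t: "t \<in> J" for t
  proof -
    have d: "(\<phi> has_real_derivative \<phi>' t) (at t)" "(\<phi>' has_real_derivative \<phi>'' t) (at t)"
      and eq: "(N - 1) * (2 * \<phi> t * \<phi>'' t - N * (\<phi>' t)\<^sup>2) = - \<alpha> * \<phi>' t / \<phi> t"
      using ode t unfolding yamabe_ode_def by auto
    note p = pos[OF t]
    have \<alpha>: "\<alpha> = A * (N - 1) * (N + 2)" unfolding A_def using N by simp
    have "(N - 1) * (2 * \<phi> t * \<phi>'' t) = (N - 1) * (N * (\<phi>' t)\<^sup>2 - A * (N + 2) * \<phi>' t / \<phi> t)"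
      using eq unfolding \<alpha> using p by (simp add: field_simps)
    then have "2 * \<phi> t * \<phi>'' t = N * (\<phi>' t)\<^sup>2 - A * (N + 2) * \<phi>' t / \<phi> t" using N by simp
    then have key: "\<phi>' t * \<phi>' t + \<phi> t * \<phi>'' t = (N / 2 + 1) * (\<phi> t * \<phi>' t - A) * \<phi>' t / \<phi> t"
      using p by (simp add: field_simps power2_eq_square)
    have pw: "((\<lambda>t. \<phi> t powr (- (N / 2 + 1))) has_real_derivative
        - (N / 2 + 1) * \<phi> t powr (- (N / 2 + 1)) * \<phi>' t / \<phi> t) (at t)"
      by (rule has_real_derivative_powr_compose[OF d(1) p])
    have "((\<lambda>t. (\<phi> t * \<phi>' t - A) * \<phi> t powr (- (N / 2 + 1))) has_real_derivative
        (\<phi>' t * \<phi>' t + \<phi> t * \<phi>'' t) * \<phi> t powr (- (N / 2 + 1))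
        + (\<phi> t * \<phi>' t - A) * (- (N / 2 + 1) * \<phi> t powr (- (N / 2 + 1)) * \<phi>' t / \<phi> t)) (at t)"
      by (rule derivative_eq_intros d pw refl)+ (simp add: algebra_simps)
    moreover have "(r * x * v / y) * w + x * (- r * w * v / y) = 0" for r x v w y :: real by simp
    ultimately show ?thesis unfolding key by (simp only:)
  qed
  from constant_of_zero_derivative[OF J this]
  obtain K where K: "\<And>t. t \<in> J \<Longrightarrow> (\<phi> t * \<phi>' t - A) * \<phi> t powr (- (N / 2 + 1)) = K" by blast
  have "\<phi> t * \<phi>' t = A + K * \<phi> t powr (N / 2 + 1)" if t: "t \<in> J" for t
  proof -
    have "\<phi> t * \<phi>' t - A = ((\<phi> t * \<phi>' t - A) * \<phi> t powr (- (N / 2 + 1))) * \<phi> t powr (N / 2 + 1)"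
      using pos[OF t] by (simp add: mult.assoc flip: powr_add)
    then show ?thesis unfolding K[OF t] by simp
  qed
  then show ?thesis unfolding A_def by blast
qed

text \<open>Every term of the equation except \<open>\<phi>''\<close> contains the factor \<open>\<phi>'\<close>.  So \<open>\<phi>'\<close> solves a
  homogeneous linear equation, and a single zero makes it vanish identically.\<close>

lemma yamabe_ode_derivative_nonzero:
  assumes ode: "yamabe_ode N \<alpha> J \<phi> \<phi>' \<phi>''" and J: "is_interval J" and N: "N > 2"
    and pos: "\<And>t. t \<in> J \<Longrightarrow> \<phi> t > 0" and nonconst: "\<not> \<phi> constant_on J" and t: "t \<in> J"
  shows "\<phi>' t \<noteq> 0"
proof
  assume 0: "\<phi>' t = 0"
  have d: "(\<phi> has_real_derivative \<phi>' s) (at s)" "(\<phi>' has_real_derivative \<phi>'' s) (at s)"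
    and eq: "(N - 1) * (2 * \<phi> s * \<phi>'' s - N * (\<phi>' s)\<^sup>2) = - \<alpha> * \<phi>' s / \<phi> s" if "s \<in> J" for s
    using ode that unfolding yamabe_ode_def by auto
  \<comment> \<open>The coefficient in \<open>\<phi>'' = p \<phi>'\<close>.\<close>
  define p where "p s = (N * \<phi>' s - \<alpha> / ((N - 1) * \<phi> s)) / (2 * \<phi> s)" for s
  have "continuous_on J \<phi>" "continuous_on J \<phi>'"
    using d by (meson DERIV_isCont continuous_at_imp_continuous_on)+
  then have "continuous_on J p"
    unfolding p_def using N pos by (intro continuous_intros) (auto simp: less_imp_neq[symmetric])
  moreover have "(\<phi>' has_real_derivative p s * \<phi>' s) (at s)" if s: "s \<in> J" for s
  proof -
    have "(N - 1) * (\<phi>'' s - p s * \<phi>' s) = 0"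
      using eq[OF s] pos[OF s] N unfolding p_def by (simp add: field_simps power2_eq_square)
    then show ?thesis using d(2)[OF s] N by simp
  qed
  ultimately have "\<phi>' s = 0" if "s \<in> J" for s
    using linear_ode_zero[OF J, of p \<phi>' t s] t 0 that by blast
  then have "\<exists>c. \<forall>s\<in>J. \<phi> s = c"
    using d(1) by (intro constant_of_zero_derivative[OF J]) metis
  then show False using nonconst unfolding constant_on_def by blast
qed

text \<open>As \<open>A > 0\<close>, the obstruction is met in negative time.  If \<open>\<phi>\<close> increases, \<open>\<phi>\<^sup>2\<close> decreases
  backwards at least linearly and would become negative.  If \<open>\<phi>\<close> decreases, then \<open>K < 0\<close>
  and the power \<open>p - 1 > 1\<close> makes \<open>\<phi>\<close> blow up; equivalently, \<open>\<phi>\<^bsup>2-p\<^esup>\<close>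
  decreases backwards at least linearly.\<close>

lemma no_global_solution_first_order:
  assumes d: "\<And>t. (\<phi> has_real_derivative \<phi>' t) (at t)"
    and eq: "\<And>t. \<phi> t * \<phi>' t = A + K * \<phi> t powr p" and p: "p > 2" and A: "A > 0"
    and pos: "\<And>t. \<phi> t > 0" and nz: "\<And>t. \<phi>' t \<noteq> 0"
  shows False
proof -
  have cont: "continuous_on UNIV \<phi>"
    using d by (meson DERIV_isCont continuous_at_imp_continuous_on)
  have "\<phi>' = (\<lambda>t. (A + K * \<phi> t powr p) / \<phi> t)"
    using eq pos by (intro ext) (metis less_imp_neq nonzero_mult_div_cancel_left)
  then have "continuous_on UNIV \<phi>'"
    using pos cont by (simp only:) (intro continuous_intros; auto simp: less_imp_neq[symmetric])
  then consider "\<And>t. \<phi>' t > 0" | "\<And>t. \<phi>' t < 0"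
    using constant_sign[of UNIV \<phi>'] nz by auto
  then show False
  proof cases
    case 1
    have mono: "\<phi> t \<le> \<phi> 0" if "t \<le> 0" for t
      using that d 1 by (intro DERIV_nonneg_imp_nondecreasing[of t 0 \<phi>]) (auto intro: less_imp_le)
    define \<delta> where "\<delta> = 2 * min A (A + K * \<phi> 0 powr p)"
    have "A + K * \<phi> 0 powr p > 0" using 1[of 0] pos[of 0] by (simp flip: eq)
    then have \<delta>: "\<delta> > 0" unfolding \<delta>_def using A by simp
    have "2 * (A + K * \<phi> t powr p) \<ge> \<delta>" if "t \<le> 0" for t
    proof (cases "K \<ge> 0")
      case True
      then show ?thesis unfolding \<delta>_def by simp
    next
      case False
      have "\<phi> t powr p \<le> \<phi> 0 powr p"
        using mono[OF that] pos[of t] p by (intro powr_mono2) auto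
      then have "K * \<phi> t powr p \<ge> K * \<phi> 0 powr p"
        using False by (simp add: mult_left_mono_neg)
      moreover have "min A (A + K * \<phi> 0 powr p) \<le> A + K * \<phi> 0 powr p" by simp
      ultimately have "min A (A + K * \<phi> 0 powr p) \<le> A + K * \<phi> t powr p"
        by (meson add_left_mono order_trans)
      then show ?thesis unfolding \<delta>_def by (rule mult_left_mono) simp
    qed
    moreover have "((\<lambda>t. (\<phi> t)\<^sup>2) has_real_derivative 2 * (A + K * \<phi> t powr p)) (at t)" for t
      unfolding eq[symmetric] by (rule derivative_eq_intros d refl)+ simp
    ultimately show False
      by (intro no_positive_function_on_left_ray[of "\<lambda>t. (\<phi> t)\<^sup>2" "\<lambda>t. 2 * (A + K * \<phi> t powr p)" \<delta>])
        (simp_all only: \<delta> pos zero_less_power)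
  next
    case 2
    have mono: "\<phi> 0 \<le> \<phi> t" if "t \<le> 0" for t
      using that d 2 by (intro DERIV_nonpos_imp_nonincreasing[of t 0 \<phi>]) (auto intro: less_imp_le)
    define \<delta> where "\<delta> = (p - 2) * (- K - A * \<phi> 0 powr (- p))"
    have "A + K * \<phi> 0 powr p < 0" using 2[of 0] pos[of 0] by (simp add: mult_pos_neg flip: eq)
    then have "A * \<phi> 0 powr (- p) + K < 0" using pos[of 0] by (simp add: powr_minus field_simps)
    then have \<delta>: "\<delta> > 0" unfolding \<delta>_def using p by simp
    have "(p - 2) * (- K - A * \<phi> t powr (- p)) \<ge> \<delta>" if "t \<le> 0" for t
    proof -
      have "\<phi> t powr (- p) \<le> \<phi> 0 powr (- p)"
        using mono[OF that] pos[of 0] p by (intro powr_mono2') auto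
      then show ?thesis unfolding \<delta>_def using p A by simp
    qed
    moreover have "((\<lambda>t. \<phi> t powr (2 - p)) has_real_derivative (p - 2) * (- K - A * \<phi> t powr (- p))) (at t)" for t
    proof -
      have "((\<lambda>t. \<phi> t powr (2 - p)) has_real_derivative (2 - p) * \<phi> t powr (2 - p - 1) * \<phi>' t) (at t)"
          by (rule DERIV_chain2[OF has_real_derivative_powr[OF pos] d])
      moreover have "\<phi> t powr (2 - p - 1) = \<phi> t powr (- p) * \<phi> t"
        using powr_add[of "\<phi> t" "- p" 1] pos[of t] by (simp add: less_imp_le)
      moreover have "(2 - p) * (\<phi> t powr (- p) * \<phi> t) * \<phi>' t
          = (2 - p) * (\<phi> t powr (- p) * (A + K * \<phi> t powr p))"
        by (simp flip: eq)
      moreover have "\<phi> t powr (- p) * (A + K * \<phi> t powr p) = A * \<phi> t powr (- p) + K * 1"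
        using pos[of t] by (simp add: distrib_left mult.left_commute flip: powr_add)
      moreover have "(2 - p) * (A * \<phi> t powr (- p) + K * 1) = (p - 2) * (- K - A * \<phi> t powr (- p))"
        by (simp add: algebra_simps)
      ultimately show ?thesis by (simp only:)
    qed
    moreover have "\<phi> t powr (2 - p) > 0" for t using pos[of t] by simp
    ultimately show False
      by (intro no_positive_function_on_left_ray[of "\<lambda>t. \<phi> t powr (2 - p)"
            "\<lambda>t. (p - 2) * (- K - A * \<phi> t powr (- p))" \<delta>]) (simp_all only: \<delta>)
  qed
qed

text \<open>Reversing time changes the signs of \<open>\<alpha>\<close> and \<open>K\<close> in the first integral, which reduces
  negative \<open>\<alpha>\<close> to positive \<open>\<alpha>\<close>.\<close>

lemma yamabe_ode_no_global_solution:
  assumes ode: "yamabe_ode N \<alpha> UNIV \<phi> \<phi>' \<phi>''" and N: "N > 2" and \<alpha>: "\<alpha> \<noteq> 0"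
    and pos: "\<And>t. \<phi> t > 0" and nonconst: "\<not> \<phi> constant_on UNIV"
  shows False
proof -
  obtain K where K: "\<phi> t * \<phi>' t = \<alpha> / ((N - 1) * (N + 2)) + K * \<phi> t powr (N / 2 + 1)" for t
    using yamabe_ode_first_integral[OF ode _ N] pos by auto
  have nz: "\<phi>' t \<noteq> 0" for t
    using yamabe_ode_derivative_nonzero[OF ode _ N _ nonconst] pos by auto
  have d: "(\<phi> has_real_derivative \<phi>' t) (at t)" for t using ode unfolding yamabe_ode_def by blast
  show False
  proof (cases "\<alpha> > 0")
    case True
    then show ?thesis using no_global_solution_first_order[OF d K _ _ pos nz] N by simp
  next
    case False
    have d': "((\<lambda>t. \<phi> (- t)) has_real_derivative - \<phi>' (- t)) (at t)" for t
    proof -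
      have "((\<lambda>t. \<phi> (- t)) has_real_derivative \<phi>' (- t) * - 1) (at t)"
        by (rule DERIV_chain2[OF d]) (auto intro!: derivative_eq_intros)
      then show ?thesis by simp
    qed
    have "\<phi> (- t) * - \<phi>' (- t) = - (\<alpha> / ((N - 1) * (N + 2))) + (- K) * \<phi> (- t) powr (N / 2 + 1)" for t
      using K[of "- t"] by simp
    moreover have "\<alpha> / ((N - 1) * (N + 2)) < 0"
      using False \<alpha> N by (intro divide_neg_pos) auto
    ultimately show ?thesis
      using no_global_solution_first_order[of "\<lambda>t. \<phi> (- t)" "\<lambda>t. - \<phi>' (- t)"
          "- (\<alpha> / ((N - 1) * (N + 2)))" "- K" "N / 2 + 1", OF d'] N pos nz by simp
  qed
qed

text \<open>Separation of variables in the first integral: \<open>G\<close> is an antiderivative of the integrand, as a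
  function of the variable \<open>y = \<phi>\<close>.\<close>

definition implicit_solution :: "real \<Rightarrow> real \<Rightarrow> real \<Rightarrow> real set \<Rightarrow> (real \<Rightarrow> real) \<Rightarrow> real \<Rightarrow> bool" where
  "implicit_solution N \<alpha> \<beta> J \<phi> \<nu> \<longleftrightarrow>
     (\<exists>G. (\<forall>y\<in>\<phi> ` J. \<alpha> - 2 * \<beta> * (N - 1) * (N + 2) / (N - 2) * y powr (N / 2 + 1) \<noteq> 0 \<and>
             (G has_real_derivative y / (\<alpha> - 2 * \<beta> * (N - 1) * (N + 2) / (N - 2) * y powr (N / 2 + 1))) (at y)) \<and>
          (\<forall>t\<in>J. (N - 1) * (N + 2) * G (\<phi> t) = t + \<nu>))"

text \<open>Up to the constant \<open>(N - 1)(N + 2)\<close>, the antiderivative is the inverse function of \<open>\<phi>\<close>, and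
  the first integral identifies its derivative \<open>1/\<phi>'\<close> with the prescribed integrand.\<close>

lemma ode_imp_implicit_solution:
  assumes ode: "yamabe_ode N \<alpha> J \<phi> \<phi>' \<phi>''" and J: "is_interval J" "open J" and N: "N > 2"
    and pos: "\<And>t. t \<in> J \<Longrightarrow> \<phi> t > 0" and nonconst: "\<not> \<phi> constant_on J"
  shows "\<exists>\<beta>. implicit_solution N \<alpha> \<beta> J \<phi> 0"
proof -
  obtain K where K: "\<And>t. t \<in> J \<Longrightarrow> \<phi> t * \<phi>' t = \<alpha> / ((N - 1) * (N + 2)) + K * \<phi> t powr (N / 2 + 1)"
    using yamabe_ode_first_integral[OF ode J(1) N pos] by blast
  have nz: "\<phi>' t \<noteq> 0" if "t \<in> J" for t by (rule yamabe_ode_derivative_nonzero[OF ode J(1) N pos nonconst that])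
  have d: "(\<phi> has_real_derivative \<phi>' t) (at t)" if "t \<in> J" for t using ode that unfolding yamabe_ode_def by blast
  \<comment> \<open>Chosen such that \<open>D\<close> below takes the value \<open>(N - 1)(N + 2) \<phi>\<phi>'\<close> at \<open>\<phi>\<close>.\<close>
  define \<beta> where "\<beta> = - K * (N - 2) / 2"
  let ?D = "\<lambda>y. \<alpha> - 2 * \<beta> * (N - 1) * (N + 2) / (N - 2) * y powr (N / 2 + 1)"
  have D: "?D (\<phi> t) = (N - 1) * (N + 2) * (\<phi> t * \<phi>' t)" if "t \<in> J" for t
  proof -
    have "2 * \<beta> * (N - 1) * (N + 2) / (N - 2) = - (K * ((N - 1) * (N + 2)))"
      unfolding \<beta>_def using N by (simp add: field_simps)
    moreover have "c * (\<alpha> / c + K * y) = \<alpha> - - (K * c) * y" if "c \<noteq> 0" for c y :: real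
      using that by (simp add: distrib_left)
    ultimately show ?thesis unfolding K[OF that] using N by simp
  qed
  have inj: "inj_on \<phi> J"
  proof (rule inj_onI, rule ccontr)
    fix s t assume st: "s \<in> J" "t \<in> J" "\<phi> s = \<phi> t" "s \<noteq> t"
    define l r where "l = min s t" and "r = max s t"
    have lr: "l < r" "\<phi> l = \<phi> r" "l \<in> J" "r \<in> J"
      using st by (auto simp: l_def r_def min_def max_def)
    have IJ: "z \<in> J" if "l \<le> z" "z \<le> r" for z
      using J(1) lr that unfolding is_interval_1 by blast
    obtain z where "l < z" "z < r" "\<phi> r - \<phi> l = (r - l) * \<phi>' z"
      using MVT2[OF lr(1), of \<phi> \<phi>'] d IJ by blast
    then show False using lr nz[of z] IJ[of z] by simp
  qed
  define G where "G y = inv_into J \<phi> y / ((N - 1) * (N + 2))" for y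
  have cont: "continuous_on J \<phi>"
    using d by (meson DERIV_isCont continuous_at_imp_continuous_on)
  have "(G has_real_derivative \<phi> t / ?D (\<phi> t)) (at (\<phi> t))" if t: "t \<in> J" for t
  proof -
    have "(inv_into J \<phi> has_real_derivative inverse (\<phi>' t)) (at (\<phi> t))"
      unfolding has_field_derivative_def
    proof (rule has_derivative_inverse_strong[OF J(2) t cont])
      show "(\<phi> has_derivative (*) (\<phi>' t)) (at t)" using d[OF t] by (simp add: has_field_derivative_def)
      show "(*) (\<phi>' t) \<circ> (*) (inverse (\<phi>' t)) = id" using nz[OF t] by (simp add: fun_eq_iff)
    qed (simp add: inj)
    then have "(G has_real_derivative inverse (\<phi>' t) / ((N - 1) * (N + 2))) (at (\<phi> t))"
      unfolding G_def by (rule DERIV_cdivide)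
    moreover have "inverse (\<phi>' t) / ((N - 1) * (N + 2)) = \<phi> t / ?D (\<phi> t)"
    proof -
      have "inverse v / c = y / (c * (y * v))" if "v \<noteq> 0" "c \<noteq> 0" "y \<noteq> 0" for v c y :: real
        using that by (simp add: field_simps)
      then show ?thesis unfolding D[OF t] using pos[OF t] nz[OF t] N by simp
    qed
    ultimately show ?thesis by simp
  qed
  moreover have "?D (\<phi> t) \<noteq> 0" if "t \<in> J" for t
    unfolding D[OF that] using pos[OF that] nz[OF that] N by simp
  moreover have "(N - 1) * (N + 2) * G (\<phi> t) = t + 0" if "t \<in> J" for t
    unfolding G_def using inj that N by simp
  ultimately have "implicit_solution N \<alpha> \<beta> J \<phi> 0"
    unfolding implicit_solution_def by blast
  then show ?thesis ..
qed

text \<open>One differentiation of the implicit formula returns the first integral, and a second one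
  eliminates its constant \<open>K\<close>.\<close>

lemma implicit_solution_imp_ode:
  assumes imp: "implicit_solution N \<alpha> \<beta> J \<phi> \<nu>" and J: "open J" and N: "N > 2"
    and pos: "\<And>t. t \<in> J \<Longrightarrow> \<phi> t > 0"
    and d: "\<And>t. t \<in> J \<Longrightarrow> (\<phi> has_real_derivative \<phi>' t) (at t)"
      "\<And>t. t \<in> J \<Longrightarrow> (\<phi>' has_real_derivative \<phi>'' t) (at t)"
  shows "yamabe_ode N \<alpha> J \<phi> \<phi>' \<phi>''"
proof -
  let ?D = "\<lambda>y. \<alpha> - 2 * \<beta> * (N - 1) * (N + 2) / (N - 2) * y powr (N / 2 + 1)"
  define K where "K = - 2 * \<beta> / (N - 2)"
  define A where "A = \<alpha> / ((N - 1) * (N + 2))"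
  define c where "c = (N - 1) * (N + 2)"
  have c: "c \<noteq> 0" unfolding c_def using N by simp
  obtain G where G: "\<And>t. t \<in> J \<Longrightarrow> ?D (\<phi> t) \<noteq> 0"
      "\<And>t. t \<in> J \<Longrightarrow> (G has_real_derivative \<phi> t / ?D (\<phi> t)) (at (\<phi> t))"
      "\<And>t. t \<in> J \<Longrightarrow> c * G (\<phi> t) = t + \<nu>"
    using imp unfolding implicit_solution_def c_def by blast
  have first: "\<phi> t * \<phi>' t = A + K * \<phi> t powr (N / 2 + 1)" if t: "t \<in> J" for t
  proof -
    have "((\<lambda>t. c * G (\<phi> t)) has_real_derivative c * (\<phi> t / ?D (\<phi> t) * \<phi>' t)) (at t)"
      by (intro DERIV_cmult DERIV_chain2[OF G(2)[OF t] d(1)[OF t]])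
    moreover have "((\<lambda>t. c * G (\<phi> t)) has_real_derivative 1) (at t)"
    proof (rule has_field_derivative_transform_within_open[OF _ J t])
      show "((\<lambda>t. t + \<nu>) has_real_derivative 1) (at t)" by (auto intro!: derivative_eq_intros)
    qed (simp add: G(3))
    ultimately have "c * (\<phi> t / ?D (\<phi> t) * \<phi>' t) = 1" by (rule DERIV_unique)
    then have "c * (\<phi> t * \<phi>' t) = ?D (\<phi> t)" using G(1)[OF t] by (simp add: field_simps)
    moreover have "?D (\<phi> t) = c * (A + K * \<phi> t powr (N / 2 + 1))"
    proof -
      have "2 * \<beta> * (N - 1) * (N + 2) / (N - 2) = - (K * c)"
        unfolding K_def c_def using N by (simp add: field_simps)
      moreover have "c * A = \<alpha>" unfolding A_def c_def[symmetric] using c by simp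
      ultimately show ?thesis by (simp add: distrib_left)
    qed
    ultimately show ?thesis using c by simp
  qed
  have "(N - 1) * (2 * \<phi> t * \<phi>'' t - N * (\<phi>' t)\<^sup>2) = - \<alpha> * \<phi>' t / \<phi> t" if t: "t \<in> J" for t
  proof -
    note p = pos[OF t]
    have "((\<lambda>t. \<phi> t * \<phi>' t) has_real_derivative \<phi>' t * \<phi>' t + \<phi> t * \<phi>'' t) (at t)"
      by (rule derivative_eq_intros d t refl)+ (simp add: algebra_simps)
    moreover have "((\<lambda>t. \<phi> t * \<phi>' t) has_real_derivative K * ((N / 2 + 1) * \<phi> t powr (N / 2 + 1) * \<phi>' t / \<phi> t)) (at t)"
    proof (rule has_field_derivative_transform_within_open[OF _ J t])
      show "((\<lambda>t. A + K * \<phi> t powr (N / 2 + 1)) has_real_derivative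
          K * ((N / 2 + 1) * \<phi> t powr (N / 2 + 1) * \<phi>' t / \<phi> t)) (at t)"
        using DERIV_add[OF DERIV_const DERIV_cmult[OF has_real_derivative_powr_compose[OF d(1)[OF t] p]]]
        by simp
    qed (simp add: first)
    ultimately have "\<phi>' t * \<phi>' t + \<phi> t * \<phi>'' t = K * ((N / 2 + 1) * \<phi> t powr (N / 2 + 1) * \<phi>' t / \<phi> t)"
      by (rule DERIV_unique)
    also have "\<dots> = (N / 2 + 1) * (K * \<phi> t powr (N / 2 + 1)) * \<phi>' t / \<phi> t"
      by simp
    also have "K * \<phi> t powr (N / 2 + 1) = \<phi> t * \<phi>' t - A" using first[OF t] by simp
    finally have "2 * \<phi> t * \<phi>'' t - N * (\<phi>' t)\<^sup>2 = - (N + 2) * A * \<phi>' t / \<phi> t"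
      using p by (simp add: field_simps power2_eq_square)
    moreover have "(N - 1) * (- (N + 2) * A * \<phi>' t / \<phi> t) = - \<alpha> * \<phi>' t / \<phi> t"
    proof -
      have "\<alpha> = c * A" unfolding A_def c_def[symmetric] using c by simp
      moreover have "(N - 1) * (- (N + 2) * A * \<phi>' t / \<phi> t) = - (c * A) * \<phi>' t / \<phi> t"
        unfolding c_def using p by (simp add: field_simps)
      ultimately show ?thesis by (simp only:)
    qed
    ultimately show ?thesis by simp
  qed
  then show ?thesis unfolding yamabe_ode_def using d by blast
qed

section \<open>The classification\<close>

theorem theorem1p8:
  fixes \<epsilon> :: "'n::finite \<Rightarrow> real" and a :: "real^'n" and k0 :: 'n
    and F :: "('q, 'm::finite) mmanifold"
    and J :: "real set" and f \<phi> h :: "real \<Rightarrow> real"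
  assumes n3: "CARD('n) \<ge> 3"
    and eps: "\<forall>i. \<epsilon> i \<in> {-1, 1}"
    and unit: "(\<Sum>k\<in>UNIV. \<epsilon> k * (a $ k)\<^sup>2) = \<epsilon> k0"
    and F: "semi_riemannian_manifold F" and flat: "scalar_flat F"
    and J: "open J" "is_interval J"
    and smooth: "smooth_on (strip a J) (\<lambda>x. f (lin_form a x))"
                "smooth_on (strip a J) (\<lambda>x. \<phi> (lin_form a x))"
                "smooth_on (strip a J) (\<lambda>x. h (lin_form a x))"
    and fpos: "\<forall>t\<in>J. f t > 0"
    and phi_nz: "\<forall>t\<in>J. \<phi> t \<noteq> 0"
    and phi_sign: "J = UNIV \<or> (\<forall>t\<in>J. \<phi> t > 0)"
    and phi_nonconst: "\<not> \<phi> constant_on J"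
  shows "(steady_gradient_yamabe_soliton
            (warped_product
               (conformal_pseudo_euclidean (strip a J) \<epsilon> (\<lambda>x. \<phi> (lin_form a x)))
               (\<lambda>x. f (lin_form a x)) F)
            (\<lambda>(x, q). h (lin_form a x))
          \<and> (\<forall>t\<in>J. deriv h t \<noteq> 0))
     \<longleftrightarrow>
     (\<exists>c \<nu> \<alpha> \<beta> :: real. \<alpha> \<noteq> 0 \<and>
        (\<forall>t\<in>J. f t = exp c / \<phi> t) \<and>
        (\<exists>H. (\<forall>t\<in>J. (H has_real_derivative 1 / (\<phi> t)\<^sup>2) (at t)) \<and> (\<forall>t\<in>J. h t = \<alpha> * H t)) \<and>
        (let n = real CARD('n); m = real CARD('m);
             D = (\<lambda>y. \<alpha> - 2 * \<beta> * (n + m - 1) * (n + m + 2) / (n + m - 2)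
                           * y powr ((n + m) / 2 + 1))
         in \<exists>G. (\<forall>y\<in>\<phi> ` J. D y \<noteq> 0 \<and> (G has_real_derivative y / D y) (at y)) \<and>
                (\<forall>t\<in>J. (n + m - 1) * (n + m + 2) * G (\<phi> t) = t + \<nu>)))"
    (is "?soliton \<and> ?h_nz \<longleftrightarrow> ?formulas")
proof -
  define N where "N = real CARD('n) + real CARD('m)"
  have N: "N > 2" using n3 unfolding N_def by simp
  have formulas: "?formulas \<longleftrightarrow> (\<exists>c \<nu> \<alpha> \<beta> :: real. \<alpha> \<noteq> 0 \<and>
        (\<forall>t\<in>J. f t = exp c / \<phi> t) \<and>
        (\<exists>H. (\<forall>t\<in>J. (H has_real_derivative 1 / (\<phi> t)\<^sup>2) (at t)) \<and> (\<forall>t\<in>J. h t = \<alpha> * H t)) \<and>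
        implicit_solution N \<alpha> \<beta> J \<phi> \<nu>)"
    unfolding implicit_solution_def N_def Let_def by (rule refl)
  have J_ne: "J \<noteq> {}" using phi_nonconst by (auto simp: constant_on_def)
  have eps1: "\<epsilon> i * \<epsilon> i = 1" for i using eps[rule_format, of i] by auto
  have eps_k0: "\<epsilon> k0 \<noteq> 0" using eps1[of k0] by auto
  have q_nz: "(\<Sum>k\<in>UNIV. \<epsilon> k * (a $ k)\<^sup>2) \<noteq> 0" unfolding unit by (rule eps_k0)
  obtain v where v: "lin_form a v = 1"
  proof -
    obtain i where "a $ i \<noteq> 0"
      using q_nz by (metis (no_types, lifting) mult_zero_right power_zero_numeral sum.neutral)
    then have "lin_form a ((1 / a $ i) *\<^sub>R axis i 1) = 1" by (simp add: lin_form_scale)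
    then show thesis using that by blast
  qed
  let ?f' = "deriv f" and ?\<phi>' = "deriv \<phi>" and ?\<phi>'' = "deriv (deriv \<phi>)" and ?h' = "deriv h" and ?h'' = "deriv (deriv h)"
  note df = smooth_profile[OF v J(1) smooth(1), rule_format]
  note d\<phi> = smooth_profile[OF v J(1) smooth(2), rule_format]
  note dh = smooth_profile[OF v J(1) smooth(3), rule_format]
  let ?A = "vec_join a (0 :: real^'m)"
  let ?S = "\<lambda>d. scalar_curvature (warped_gram \<epsilon> a \<phi> f (gram d))"
  have F_open: "open (crange d)" if "d \<in> charts F" for d
    using F that unfolding semi_riemannian_manifold_def smooth_manifold_def by blast
  have wm: "warped_metric \<epsilon> (gram d) (crange d) J f ?f' \<phi> ?\<phi>' ?\<phi>'' h ?h' ?h''" if d: "d \<in> charts F" for d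
  proof
    have G: "smooth_on (crange d) (gram d)"
      "\<And>x. x \<in> crange d \<Longrightarrow> transpose (gram d x) = gram d x" "\<And>x. x \<in> crange d \<Longrightarrow> invertible (gram d x)"
      using F d unfolding semi_riemannian_manifold_def by blast+
    show "gram d y $ k $ l = gram d y $ l $ k" if "y \<in> crange d" for y k l
      using arg_cong[OF G(2)[OF that], of "\<lambda>A. A $ l $ k"] by (simp add: transpose_def)
    show "invertible (gram d y)" if "y \<in> crange d" for y by (rule G(3)[OF that])
    show "twice_differentiable (crange d) (\<lambda>y. gram d y $ k $ l)" for k l
      by (rule smooth_matrix_entry[OF F_open[OF d] G(1)])
  qed (use eps1 J F_open[OF d] fpos phi_nz df d\<phi> dh in \<open>auto simp: less_imp_neq[symmetric]\<close>)
  have two: "CARD('n) \<ge> 2" using n3 by simp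
  have soliton: "?soliton \<longleftrightarrow> (\<forall>d\<in>charts F. \<forall>z. lin_form ?A z \<in> J \<and> vec_snd z \<in> crange d \<longrightarrow>
      ?h'' (lin_form ?A z) * \<phi> (lin_form ?A z) + 2 * ?\<phi>' (lin_form ?A z) * ?h' (lin_form ?A z) = 0 \<and>
      ?S d z = - \<epsilon> k0 * \<phi> (lin_form ?A z) * ?\<phi>' (lin_form ?A z) * ?h' (lin_form ?A z) \<and>
      ?S d z * f (lin_form ?A z) = \<epsilon> k0 * (\<phi> (lin_form ?A z))\<^sup>2 * ?f' (lin_form ?A z) * ?h' (lin_form ?A z))"
  proof -
    have W: "vec_fst z \<in> strip a J \<longleftrightarrow> lin_form ?A z \<in> J" for z :: "real^('n + 'm)"
      by (simp add: strip_def lin_form_vec_fst)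
    have coords: "?soliton \<longleftrightarrow> (\<forall>d\<in>charts F. \<forall>z. lin_form ?A z \<in> J \<and> vec_snd z \<in> crange d \<longrightarrow>
        ?S d z *\<^sub>R warped_gram \<epsilon> a \<phi> f (gram d) z = hessian (warped_gram \<epsilon> a \<phi> f (gram d)) (\<lambda>z. h (lin_form ?A z)) z)"
      unfolding W[symmetric] by (rule soliton_in_coordinates[OF J(1)]) (rule F_open)
    show ?thesis
      unfolding coords
    proof (intro ball_cong refl arg_cong[where f = All] ext imp_cong)
      fix d and z :: "real^('n + 'm)"
      assume d: "d \<in> charts F" and z: "lin_form ?A z \<in> J \<and> vec_snd z \<in> crange d"
      show "(?S d z *\<^sub>R warped_gram \<epsilon> a \<phi> f (gram d) z = hessian (warped_gram \<epsilon> a \<phi> f (gram d)) (\<lambda>z. h (lin_form ?A z)) z)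
        = (?h'' (lin_form ?A z) * \<phi> (lin_form ?A z) + 2 * ?\<phi>' (lin_form ?A z) * ?h' (lin_form ?A z) = 0 \<and>
      ?S d z = - \<epsilon> k0 * \<phi> (lin_form ?A z) * ?\<phi>' (lin_form ?A z) * ?h' (lin_form ?A z) \<and>
      ?S d z * f (lin_form ?A z) = \<epsilon> k0 * (\<phi> (lin_form ?A z))\<^sup>2 * ?f' (lin_form ?A z) * ?h' (lin_form ?A z))"
        using warped_metric.soliton_at_point[where a = a, OF wm[OF d] _ two q_nz, of z] z W[of z] unfolding unit by simp
    qed
  qed
  have S: "?S d z = (N - 1) * (2 * \<phi> t * ?\<phi>'' t - N * (?\<phi>' t)\<^sup>2) * \<epsilon> k0"
    if d: "d \<in> charts F" and z: "t \<in> J" "lin_form ?A z = t" "vec_snd z \<in> crange d"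
      and C: "C \<noteq> 0" "\<And>t. t \<in> J \<Longrightarrow> f t = C / \<phi> t" for d z t C
  proof -
    have "scalar_curvature (gram d) (vec_snd z) = 0" using flat d z(3) unfolding scalar_flat_def by blast
    then show ?thesis
      using warped_metric.scalar_curvature_warped_gram[where a = a, OF wm[OF d] _ C(2,1), of z] z
      unfolding unit N_def by (simp add: strip_def lin_form_vec_fst)
  qed
  have const: "\<exists>c. \<forall>t\<in>J. u t = c" if "\<And>t. t \<in> J \<Longrightarrow> (u has_real_derivative 0) (at t)" for u :: "real \<Rightarrow> real"
    by (rule constant_of_zero_derivative[OF J(2) that])
  show ?thesis unfolding formulas
  proof
    assume L: "?soliton \<and> ?h_nz"
    then have h_nz: "\<And>t. t \<in> J \<Longrightarrow> ?h' t \<noteq> 0" by blast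
    obtain d y where d: "d \<in> charts F" and y: "y \<in> crange d"
    proof -
      have "topspace (mtop F) \<noteq> {}" "(\<Union>c\<in>charts F. cdom c) = topspace (mtop F)"
        using F unfolding semi_riemannian_manifold_def smooth_manifold_def by blast+
      then obtain d p where "d \<in> charts F" "p \<in> cdom d" by blast
      then show thesis using that unfolding crange_def by blast
    qed
    \<comment> \<open>A point over each value of \<open>\<xi>\<close>: the equations in \<open>\<xi>\<close> can be read off along one curve.\<close>
    define z where "z t = vec_join (t *\<^sub>R v) y" for t
    have z: "lin_form ?A (z t) = t" "vec_snd (z t) \<in> crange d" for t
      using y by (simp_all add: z_def lin_form_vec_fst[symmetric] lin_form_scale v)
    have eqs: "?h'' t * \<phi> t + 2 * ?\<phi>' t * ?h' t = 0" "?S d (z t) = - \<epsilon> k0 * \<phi> t * ?\<phi>' t * ?h' t"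
      "?S d (z t) * f t = \<epsilon> k0 * (\<phi> t)\<^sup>2 * ?f' t * ?h' t" if "t \<in> J" for t
      using L[unfolded soliton, THEN conjunct1, rule_format, OF d, of "z t"] z that by auto
    have "((\<lambda>t. f t * \<phi> t) has_real_derivative 0) (at t)" if t: "t \<in> J" for t
    proof -
      \<comment> \<open>The two expressions for \<open>S\<close> are compared; its value is not yet known.\<close>
      have "(\<epsilon> k0 * \<phi> t * ?h' t) * (f t * ?\<phi>' t + ?f' t * \<phi> t) = 0"
        using eqs(2,3)[OF t] by (simp add: power2_eq_square algebra_simps)
      then have "f t * ?\<phi>' t + ?f' t * \<phi> t = 0"
        using eps1[of k0] h_nz[OF t] phi_nz t by auto
      moreover have "((\<lambda>t. f t * \<phi> t) has_real_derivative f t * ?\<phi>' t + ?f' t * \<phi> t) (at t)"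
        by (rule derivative_eq_intros df(1) d\<phi>(1) t refl)+ (simp add: algebra_simps)
      ultimately show ?thesis by simp
    qed
    from const[OF this] obtain C where C: "f t * \<phi> t = C" if "t \<in> J" for t by blast
    have C_nz: "C \<noteq> 0" using C J_ne fpos phi_nz by (metis all_not_in_conv less_irrefl mult_eq_0_iff)
    have fC: "f t = C / \<phi> t" if "t \<in> J" for t using C[OF that] phi_nz that by (simp add: field_simps)
    have "((\<lambda>t. (\<phi> t)\<^sup>2 * ?h' t) has_real_derivative 0) (at t)" if t: "t \<in> J" for t
    proof -
      have "((\<lambda>t. (\<phi> t)\<^sup>2 * ?h' t) has_real_derivative \<phi> t * (?h'' t * \<phi> t + 2 * ?\<phi>' t * ?h' t)) (at t)"
        by (rule derivative_eq_intros dh(2) d\<phi>(1) t refl)+ (simp add: power2_eq_square algebra_simps)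
      then show ?thesis unfolding eqs(1)[OF t] by simp
    qed
    from const[OF this] obtain \<alpha> where \<alpha>: "(\<phi> t)\<^sup>2 * ?h' t = \<alpha>" if "t \<in> J" for t by blast
    have \<alpha>_nz: "\<alpha> \<noteq> 0" using \<alpha> J_ne h_nz phi_nz by (metis all_not_in_conv mult_eq_0_iff power_eq_0_iff)
    have h': "?h' t = \<alpha> / (\<phi> t)\<^sup>2" if "t \<in> J" for t using \<alpha>[OF that] phi_nz that by (simp add: field_simps)
    have second: "(N - 1) * (2 * \<phi> t * ?\<phi>'' t - N * (?\<phi>' t)\<^sup>2) = - \<alpha> * ?\<phi>' t / \<phi> t" if t: "t \<in> J" for t
    proof -
      have "(N - 1) * (2 * \<phi> t * ?\<phi>'' t - N * (?\<phi>' t)\<^sup>2) * \<epsilon> k0 = - (\<phi> t * ?\<phi>' t * ?h' t) * \<epsilon> k0"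
        using S[OF d t z C_nz fC] eqs(2)[OF t] by (simp add: mult_ac)
      then have "(N - 1) * (2 * \<phi> t * ?\<phi>'' t - N * (?\<phi>' t)\<^sup>2) = - (\<phi> t * ?\<phi>' t * ?h' t)"
        by (rule mult_right_cancel[OF eps_k0, THEN iffD1])
      also have "\<dots> = - \<alpha> * ?\<phi>' t / \<phi> t"
        unfolding h'[OF t] using phi_nz t by (simp add: field_simps power2_eq_square)
      finally show ?thesis .
    qed
    have "continuous_on J \<phi>"
      using d\<phi>(1) by (meson DERIV_isCont continuous_at_imp_continuous_on)
    then consider "\<forall>t\<in>J. \<phi> t > 0" | "\<forall>t\<in>J. \<phi> t < 0"
      using constant_sign[OF J(2)] phi_nz by blast
    then have pos: "\<forall>t\<in>J. \<phi> t > 0"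
    proof cases
      case 2
      \<comment> \<open>The equation is invariant under \<open>\<phi> \<mapsto> -\<phi>\<close>, so \<open>-\<phi>\<close> is a positive global solution.\<close>
      then have UNIV: "J = UNIV" using phi_sign J_ne by force
      have "yamabe_ode N \<alpha> UNIV (\<lambda>t. - \<phi> t) (\<lambda>t. - ?\<phi>' t) (\<lambda>t. - ?\<phi>'' t)"
        unfolding yamabe_ode_def using second d\<phi> unfolding UNIV by (auto intro: DERIV_minus)
      moreover have "\<not> (\<lambda>t. - \<phi> t) constant_on UNIV"
        using phi_nonconst unfolding UNIV constant_on_def by (metis minus_minus)
      ultimately have False
        using yamabe_ode_no_global_solution[of N \<alpha> "\<lambda>t. - \<phi> t"] N \<alpha>_nz 2 unfolding UNIV by auto
      then show ?thesis ..
    qed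
    have "yamabe_ode N \<alpha> J \<phi> ?\<phi>' ?\<phi>''" unfolding yamabe_ode_def using second d\<phi> by blast
    then obtain \<beta> where \<beta>: "implicit_solution N \<alpha> \<beta> J \<phi> 0"
      using ode_imp_implicit_solution[OF _ J(2,1) N _ phi_nonconst] pos by blast
    have "C > 0" using C J_ne fpos pos by (metis all_not_in_conv mult_pos_pos)
    then have "\<forall>t\<in>J. f t = exp (ln C) / \<phi> t" using fC by simp
    moreover have "(\<forall>t\<in>J. ((\<lambda>t. h t / \<alpha>) has_real_derivative 1 / (\<phi> t)\<^sup>2) (at t)) \<and> (\<forall>t\<in>J. h t = \<alpha> * (h t / \<alpha>))"
    proof (intro conjI ballI)
      fix t assume t: "t \<in> J"
      show "((\<lambda>t. h t / \<alpha>) has_real_derivative 1 / (\<phi> t)\<^sup>2) (at t)"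
        using DERIV_cdivide[OF dh(1)[OF t], of \<alpha>] h'[OF t] \<alpha>_nz by simp
    qed (use \<alpha>_nz in simp)
    ultimately show "\<exists>c \<nu> \<alpha> \<beta> :: real. \<alpha> \<noteq> 0 \<and>
        (\<forall>t\<in>J. f t = exp c / \<phi> t) \<and>
        (\<exists>H. (\<forall>t\<in>J. (H has_real_derivative 1 / (\<phi> t)\<^sup>2) (at t)) \<and> (\<forall>t\<in>J. h t = \<alpha> * H t)) \<and>
        implicit_solution N \<alpha> \<beta> J \<phi> \<nu>"
      using \<alpha>_nz \<beta> by blast
  next
    assume "\<exists>c \<nu> \<alpha> \<beta> :: real. \<alpha> \<noteq> 0 \<and>
        (\<forall>t\<in>J. f t = exp c / \<phi> t) \<and>
        (\<exists>H. (\<forall>t\<in>J. (H has_real_derivative 1 / (\<phi> t)\<^sup>2) (at t)) \<and> (\<forall>t\<in>J. h t = \<alpha> * H t)) \<and>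
        implicit_solution N \<alpha> \<beta> J \<phi> \<nu>"
    then obtain c \<nu> \<alpha> \<beta> H where \<alpha>_nz: "\<alpha> \<noteq> 0" and fc: "\<And>t. t \<in> J \<Longrightarrow> f t = exp c / \<phi> t"
      and H: "\<And>t. t \<in> J \<Longrightarrow> (H has_real_derivative 1 / (\<phi> t)\<^sup>2) (at t)" "\<And>t. t \<in> J \<Longrightarrow> h t = \<alpha> * H t"
      and imp: "implicit_solution N \<alpha> \<beta> J \<phi> \<nu>"
      by blast
    have pos: "\<phi> t > 0" if "t \<in> J" for t
      using fpos[rule_format, OF that] unfolding fc[OF that] by (simp add: zero_less_divide_iff)
    have ode: "yamabe_ode N \<alpha> J \<phi> ?\<phi>' ?\<phi>''"
      by (rule implicit_solution_imp_ode[OF imp J(1) N pos d\<phi>])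
    have h': "?h' t = \<alpha> / (\<phi> t)\<^sup>2" if t: "t \<in> J" for t
    proof -
      have "(h has_real_derivative \<alpha> * (1 / (\<phi> t)\<^sup>2)) (at t)"
        by (rule has_field_derivative_transform_within_open[OF DERIV_cmult[OF H(1)[OF t]] J(1) t]) (simp add: H(2))
      then show ?thesis by (simp add: DERIV_imp_deriv)
    qed
    have h'': "?h'' t * \<phi> t + 2 * ?\<phi>' t * ?h' t = 0" if t: "t \<in> J" for t
    proof -
      have "((\<lambda>t. (\<phi> t)\<^sup>2 * ?h' t) has_real_derivative \<phi> t * (?h'' t * \<phi> t + 2 * ?\<phi>' t * ?h' t)) (at t)"
        by (rule derivative_eq_intros dh(2) d\<phi>(1) t refl)+ (simp add: power2_eq_square algebra_simps)
      moreover have "((\<lambda>t. (\<phi> t)\<^sup>2 * ?h' t) has_real_derivative 0) (at t)"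
        by (rule has_field_derivative_transform_within_open[OF DERIV_const J(1) t, of \<alpha>])
           (use h' phi_nz in simp)
      ultimately show ?thesis using DERIV_unique pos[OF t] by fastforce
    qed
    have f': "f t * ?\<phi>' t + ?f' t * \<phi> t = 0" if t: "t \<in> J" for t
    proof -
      have "((\<lambda>t. f t * \<phi> t) has_real_derivative f t * ?\<phi>' t + ?f' t * \<phi> t) (at t)"
        by (rule derivative_eq_intros df(1) d\<phi>(1) t refl)+ (simp add: algebra_simps)
      moreover have "((\<lambda>t. f t * \<phi> t) has_real_derivative 0) (at t)"
        by (rule has_field_derivative_transform_within_open[OF DERIV_const J(1) t, of "exp c"])
           (use fc phi_nz in simp)
      ultimately show ?thesis by (rule DERIV_unique)
    qed
    have ?soliton unfolding soliton
    proof (intro ballI allI impI)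
      fix d and z :: "real^('n + 'm)"
      assume d: "d \<in> charts F" and z: "lin_form ?A z \<in> J \<and> vec_snd z \<in> crange d"
      define t where "t = lin_form ?A z"
      have t: "t \<in> J" using z unfolding t_def by blast
      have "?S d z = (N - 1) * (2 * \<phi> t * ?\<phi>'' t - N * (?\<phi>' t)\<^sup>2) * \<epsilon> k0"
        by (rule S[OF d t _ _ _ fc]) (use z in \<open>auto simp: t_def\<close>)
      also have "(N - 1) * (2 * \<phi> t * ?\<phi>'' t - N * (?\<phi>' t)\<^sup>2) = - \<alpha> * ?\<phi>' t / \<phi> t"
        using ode t unfolding yamabe_ode_def by blast
      also have "\<dots> = - \<phi> t * ?\<phi>' t * ?h' t"
        unfolding h'[OF t] using pos[OF t] by (simp add: field_simps power2_eq_square)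
      finally have S: "?S d z = - \<epsilon> k0 * \<phi> t * ?\<phi>' t * ?h' t" by simp
      have "?S d z * f t = - (\<epsilon> k0 * \<phi> t * ?h' t) * (f t * ?\<phi>' t)"
        unfolding S by (simp add: mult_ac)
      also have "f t * ?\<phi>' t = - (?f' t * \<phi> t)" using f'[OF t] by simp
      finally have "?S d z * f t = \<epsilon> k0 * (\<phi> t)\<^sup>2 * ?f' t * ?h' t"
        by (simp add: power2_eq_square mult_ac)
      then show "?h'' (lin_form ?A z) * \<phi> (lin_form ?A z) + 2 * ?\<phi>' (lin_form ?A z) * ?h' (lin_form ?A z) = 0 \<and>
          ?S d z = - \<epsilon> k0 * \<phi> (lin_form ?A z) * ?\<phi>' (lin_form ?A z) * ?h' (lin_form ?A z) \<and>
          ?S d z * f (lin_form ?A z) = \<epsilon> k0 * (\<phi> (lin_form ?A z))\<^sup>2 * ?f' (lin_form ?A z) * ?h' (lin_form ?A z)"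
        using h''[OF t] S unfolding t_def by blast
    qed
    moreover have ?h_nz using h' \<alpha>_nz phi_nz by simp
    ultimately show "?soliton \<and> ?h_nz" by blast
  qed
qed

end
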